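(* Let $W$ be the Weyl group of an irreducible reduced crystallographic root system of rank $n$ in the Euclidean space $E_n$, and let $F$ be the fundamental simplex of the affine Weyl group $W^{\rm aff}$. For $\lambda\in P_+$ let $\phi_\lambda(x)=\sum_{\mu\in O(\lambda)}e^{2\pi \mathrm{i}\langle\mu,x\rangle}$. Then for all $\lambda,\lambda'\in P_+$, $$|\overline F|^{-1}\int_{\overline F}\phi_\lambda(x)\,\overline{\phi_{\lambda'}(x)}\,dx=|O(\lambda)|\,\delta_{\lambda\lambda'},$$ where $dx$ is the Euclidean (Lebesgue) measure on $E_n$ and $|\overline F|$ is the volume of $\overline F$.
   Context: $R$ is an irreducible reduced crystallographic root system spanning the Euclidean space $E_n$ with scalar product $\langle\cdot,\cdot\rangle$, with simple roots $\alpha_1,\dots,\alpha_n$, normalized so that long roots have squared length $2$ (all roots count as long if there is only one length). For a root $\alpha$, $\alpha^\vee=2\alpha/\langle\alpha,\alpha\rangle$ and $r_\alpha x=x-\langle x,\alpha^\vee\rangle\alpha$. $W$ is the group generated by $r_{\alpha_1},\dots,r_{\alpha_n}$. $D_+=\{x\in E_n:\langle x,\alpha_i\rangle\ge 0\ \forall i\}$; $P=\{\lambda\in E_n:\langle\lambda,\alpha_j^\vee\rangle\in\mathbb Z\ \forall j\}$ and $P_+=P\cap D_+$. $O(\lambda)=\{w\lambda:w\in W\}$ (distinct points) and $|O(\lambda)|$ is its number of elements. Let $\xi$ be the highest root. The affine Weyl group $W^{\rm aff}$ is generated by $r_{\alpha_1},\dots,r_{\alpha_n}$ and $r_0x=r_\xi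 x+\xi^\vee$. $F$ is the open simplex $\{y\in E_n:\langle y,\alpha_i\rangle>0\ (i=1,\dots,n),\ \langle y,\xi\rangle<1\}$ and $\overline F$ its closure. *)

theory Defs
  imports "HOL-Analysis.Analysis" "HOL-Algebra.Bij" "HOL-Algebra.Generated_Groups"
begin

definition coroot :: "'a::euclidean_space \<Rightarrow> 'a" where
  "coroot \<alpha> = (2 / (\<alpha> \<bullet> \<alpha>)) *\<^sub>R \<alpha>"

definition root_reflection :: "'a::euclidean_space \<Rightarrow> 'a \<Rightarrow> 'a" where
  "root_reflection \<alpha> x = x - (x \<bullet> coroot \<alpha>) *\<^sub>R \<alpha>"

definition root_system :: "'a::euclidean_space set \<Rightarrow> bool" where
  "root_system R \<longleftrightarrow>
     finite R \<and> 0 \<notin> R \<and> span R = UNIV \<and> (\<forall>\<alpha>\<in>R. root_reflection \<alpha> ` R = R)"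

definition crystallographic :: "'a::euclidean_space set \<Rightarrow> bool" where
  "crystallographic R \<longleftrightarrow> (\<forall>\<alpha>\<in>R. \<forall>\<beta>\<in>R. \<beta> \<bullet> coroot \<alpha> \<in> \<int>)"

definition reduced :: "'a::euclidean_space set \<Rightarrow> bool" where
  "reduced R \<longleftrightarrow> (\<forall>\<alpha>\<in>R. \<forall>c::real. c *\<^sub>R \<alpha> \<in> R \<longrightarrow> c = 1 \<or> c = -1)"

definition irreducible_system :: "'a::euclidean_space set \<Rightarrow> bool" where
  "irreducible_system R \<longleftrightarrow>
     R \<noteq> {} \<and> \<not> (\<exists>A B. A \<noteq> {} \<and> B \<noteq> {} \<and> A \<inter> B = {} \<and> A \<union> B = R \<and>
                    (\<forall>\<alpha>\<in>A. \<forall>\<beta>\<in>B. \<alpha> \<bullet> \<beta> = 0))"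

definition long_root :: "'a::euclidean_space set \<Rightarrow> 'a \<Rightarrow> bool" where
  "long_root R \<alpha> \<longleftrightarrow> \<alpha> \<in> R \<and> (\<forall>\<beta>\<in>R. norm \<beta> \<le> norm \<alpha>)"

definition normalized :: "'a::euclidean_space set \<Rightarrow> bool" where
  "normalized R \<longleftrightarrow> (\<forall>\<alpha>. long_root R \<alpha> \<longrightarrow> \<alpha> \<bullet> \<alpha> = 2)"

definition nonneg_combinations :: "'a::euclidean_space set \<Rightarrow> 'a set" where
  "nonneg_combinations \<Delta> = {\<Sum>\<alpha>\<in>\<Delta>. real (c \<alpha>) *\<^sub>R \<alpha> | c :: 'a \<Rightarrow> nat. True}"

text \<open>The simple roots are given as an unordered set rather than as an indexed family;
  being a basis of the space, it has exactly \<open>DIM('a)\<close> elements.\<close>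

definition simple_roots :: "'a::euclidean_space set \<Rightarrow> 'a set \<Rightarrow> bool" where
  "simple_roots R \<Delta> \<longleftrightarrow>
     \<Delta> \<subseteq> R \<and> independent \<Delta> \<and> span \<Delta> = UNIV \<and>
     (\<forall>\<beta>\<in>R. \<beta> \<in> nonneg_combinations \<Delta> \<or> - \<beta> \<in> nonneg_combinations \<Delta>)"

definition highest_root :: "'a::euclidean_space set \<Rightarrow> 'a set \<Rightarrow> 'a \<Rightarrow> bool" where
  "highest_root R \<Delta> \<xi> \<longleftrightarrow> \<xi> \<in> R \<and> (\<forall>\<beta>\<in>R. \<xi> - \<beta> \<in> nonneg_combinations \<Delta>)"

definition weyl_group :: "'a::euclidean_space set \<Rightarrow> ('a \<Rightarrow> 'a) set" where
  "weyl_group \<Delta> = generate (BijGroup UNIV) (root_reflection ` \<Delta>)"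

definition weyl_orbit :: "'a::euclidean_space set \<Rightarrow> 'a \<Rightarrow> 'a set" where
  "weyl_orbit \<Delta> l = {w l | w. w \<in> weyl_group \<Delta>}"

definition dominant_chamber :: "'a::euclidean_space set \<Rightarrow> 'a set" where
  "dominant_chamber \<Delta> = {x. \<forall>\<alpha>\<in>\<Delta>. x \<bullet> \<alpha> \<ge> 0}"

definition weight_lattice :: "'a::euclidean_space set \<Rightarrow> 'a set" where
  "weight_lattice \<Delta> = {l. \<forall>\<alpha>\<in>\<Delta>. l \<bullet> coroot \<alpha> \<in> \<int>}"

definition dominant_weights :: "'a::euclidean_space set \<Rightarrow> 'a set" where
  "dominant_weights \<Delta> = weight_lattice \<Delta> \<inter> dominant_chamber \<Delta>"

definition affine_weyl_group :: "'a::euclidean_space set \<Rightarrow> 'a \<Rightarrow> ('a \<Rightarrow> 'a) set" where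
  "affine_weyl_group \<Delta> \<xi> =
     generate (BijGroup UNIV)
       (insert (\<lambda>x. root_reflection \<xi> x + coroot \<xi>) (root_reflection ` \<Delta>))"

text \<open>The open fundamental simplex of \<^const>\<open>affine_weyl_group\<close>, given by its explicit
  inequalities.\<close>

definition fundamental_simplex :: "'a::euclidean_space set \<Rightarrow> 'a \<Rightarrow> 'a set" where
  "fundamental_simplex \<Delta> \<xi> = {y. (\<forall>\<alpha>\<in>\<Delta>. y \<bullet> \<alpha> > 0) \<and> y \<bullet> \<xi> < 1}"

definition orbit_function :: "'a::euclidean_space set \<Rightarrow> 'a \<Rightarrow> 'a \<Rightarrow> complex" where
  "orbit_function \<Delta> l x =
     (\<Sum>\<mu>\<in>weyl_orbit \<Delta> l. exp (2 * complex_of_real pi * \<i> * complex_of_real (\<mu> \<bullet> x)))"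

end

theory Submission
  imports Defs
begin

text \<open>
  The group of maps \<open>x \<mapsto> w (x + q)\<close> with \<open>w\<close> in the Weyl group and \<open>q\<close> in the coroot lattice
  permutes the hyperplanes \<open>x \<bullet> \<beta> = k\<close>, and \<open>F\<close> is not cut by any of them. Hence the number of
  images of a point \<open>x\<close> lying in \<open>F\<close> is the same for almost all \<open>x\<close>; that this number is 1 is not
  needed. The function counting the \<open>w\<close> with \<open>w x \<in> F\<close> therefore has a constant periodization,
  so its integral against a nontrivial character of the weight lattice vanishes: a translation that
  changes the sign of the character does not change the integral. Averaging over the Weyl group, only the
  diagonal terms of the product of two orbit functions contribute to the integral over \<open>F\<close>. That
  different dominant weights have disjoint orbits follows from the exchange property of words in the
  simple reflections.
\<close>

section \<open>Integration on Euclidean spaces\<close>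

text \<open>The Jacobian factor \<open>\<bar>c\<bar> ^ DIM('a)\<close> is 1. The uses are
  translations and, with \<open>c = -1\<close>, point reflections.\<close>

lemma nn_integral_lborel_affine:
  fixes g :: "'a::euclidean_space \<Rightarrow> ennreal"
  assumes g: "g \<in> borel_measurable borel" and c: "\<bar>c\<bar> = 1"
  shows "(\<integral>\<^sup>+ x. g (t + c *\<^sub>R x) \<partial>lborel) = (\<integral>\<^sup>+ x. g x \<partial>lborel)"
proof -
  have "(lborel :: 'a measure) = density (distr lborel borel (\<lambda>x. t + c *\<^sub>R x)) (\<lambda>_. \<bar>c\<bar> ^ DIM('a))"
    using c by (intro lborel_affine) auto
  then have "(lborel :: 'a measure) = distr lborel borel (\<lambda>x. t + c *\<^sub>R x)"
    using c by (simp add: density_1)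
  then have "(\<integral>\<^sup>+ x. g x \<partial>lborel) = (\<integral>\<^sup>+ x. g x \<partial>distr lborel borel (\<lambda>x. t + c *\<^sub>R x))"
    by simp
  also have "\<dots> = (\<integral>\<^sup>+ x. g (t + c *\<^sub>R x) \<partial>lborel)"
    using g by (intro nn_integral_distr) auto
  finally show ?thesis by simp
qed

text \<open>The argument is the uniqueness of a translation-invariant measure: integrating
  \<open>1\<^sub>A (f x) * 1\<^sub>B (f x + y)\<close> in both orders, with \<open>B\<close> the unit ball, which \<open>f\<close> preserves.\<close>

lemma distr_lborel_orthogonal_transformation:
  fixes f :: "'a::euclidean_space \<Rightarrow> 'a"
  assumes f: "orthogonal_transformation f"
  shows "distr lborel borel f = lborel"
proof (rule measure_eqI)
  fix A assume "A \<in> sets (distr lborel borel f)"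
  then have A [measurable]: "A \<in> sets borel" by simp
  have lin: "linear f" using f by (rule orthogonal_transformation_linear)
  have fm [measurable]: "f \<in> borel_measurable borel"
    using lin by (intro borel_measurable_continuous_onI linear_continuous_on)
      (simp add: linear_conv_bounded_linear)
  define B where "B = ball (0::'a) 1"
  have B [measurable]: "B \<in> sets borel" by (simp add: B_def)
  have fB: "indicator B (f x) = (indicator B x :: ennreal)" for x
    using f by (simp add: B_def indicator_def orthogonal_transformation_norm)
  have mA: "(\<integral>\<^sup>+ x. indicator A (f x) \<partial>lborel) = emeasure (distr lborel borel f) A"
    by (simp flip: nn_integral_indicator add: nn_integral_distr)
  have "(\<integral>\<^sup>+ y. \<integral>\<^sup>+ x. indicator A (f x) * indicator B (f x + y) \<partial>lborel \<partial>lborel)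
      = (\<integral>\<^sup>+ x. \<integral>\<^sup>+ y. indicator A (f x) * indicator B (f x + y) \<partial>lborel \<partial>lborel)"
    by (rule lborel_pair.Fubini') measurable
  also have "\<dots> = (\<integral>\<^sup>+ x. indicator A (f x) * emeasure lborel B \<partial>lborel)"
  proof (rule nn_integral_cong)
    fix x
    have "(\<integral>\<^sup>+ y. indicator B (f x + y) \<partial>lborel) = emeasure lborel B"
      using nn_integral_lborel_affine [of "indicator B" 1 "f x"] by simp
    then show "(\<integral>\<^sup>+ y. indicator A (f x) * indicator B (f x + y) \<partial>lborel)
        = indicator A (f x) * emeasure lborel B"
      by (subst nn_integral_cmult) auto
  qed
  also have "\<dots> = emeasure (distr lborel borel f) A * emeasure lborel B"
    by (subst nn_integral_multc) (auto simp: mA)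
  finally have 1: "(\<integral>\<^sup>+ y. \<integral>\<^sup>+ x. indicator A (f x) * indicator B (f x + y) \<partial>lborel \<partial>lborel)
      = emeasure (distr lborel borel f) A * emeasure lborel B" .
  have "(\<integral>\<^sup>+ y. \<integral>\<^sup>+ x. indicator A (f x) * indicator B (f x + y) \<partial>lborel \<partial>lborel)
      = (\<integral>\<^sup>+ y. \<integral>\<^sup>+ x. indicator A (f x - y) * indicator B (f x) \<partial>lborel \<partial>lborel)"
  proof (rule nn_integral_cong)
    fix y
    \<comment> \<open>Writing \<open>y = f y'\<close> turns the shift by \<open>y\<close> in the
      image into a shift of the integration variable.\<close>
    obtain y' where y': "y = f y'"
      using orthogonal_transformation_surj [OF f] by (metis surjD)
    have "(\<lambda>x. indicator A (f x) * indicator B (f x + y) :: ennreal) \<in> borel_measurable borel"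
      by measurable
    from nn_integral_lborel_affine [OF this, of 1 "- y'"]
    have "(\<integral>\<^sup>+ x. indicator A (f (- y' + 1 *\<^sub>R x)) * indicator B (f (- y' + 1 *\<^sub>R x) + y) \<partial>lborel)
        = (\<integral>\<^sup>+ x. indicator A (f x) * indicator B (f x + y) \<partial>lborel)"
      by simp
    moreover have "f (- y' + 1 *\<^sub>R x) = f x - y" for x
      using lin y' by (simp add: linear_diff)
    ultimately show "(\<integral>\<^sup>+ x. indicator A (f x) * indicator B (f x + y) \<partial>lborel)
        = (\<integral>\<^sup>+ x. indicator A (f x - y) * indicator B (f x) \<partial>lborel)" by simp
  qed
  also have "\<dots> = (\<integral>\<^sup>+ x. \<integral>\<^sup>+ y. indicator A (f x - y) * indicator B (f x) \<partial>lborel \<partial>lborel)"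
    by (rule lborel_pair.Fubini') measurable
  also have "\<dots> = (\<integral>\<^sup>+ x. emeasure lborel A * indicator B x \<partial>lborel)"
  proof (rule nn_integral_cong)
    fix x
    have "(\<integral>\<^sup>+ y. indicator A (f x - y) \<partial>lborel) = emeasure lborel A"
      using nn_integral_lborel_affine [of "indicator A" "-1" "f x"] by simp
    then show "(\<integral>\<^sup>+ y. indicator A (f x - y) * indicator B (f x) \<partial>lborel)
        = emeasure lborel A * indicator B x"
      by (subst nn_integral_multc) (auto simp: fB)
  qed
  also have "\<dots> = emeasure lborel A * emeasure lborel B"
    by (subst nn_integral_cmult) auto
  finally have "emeasure (distr lborel borel f) A * emeasure lborel B
      = emeasure lborel A * emeasure lborel B"
    using 1 by simp
  \<comment> \<open>The ball has finite and nonzero measure, so its measure can be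
    cancelled.\<close>
  moreover have "emeasure lborel B \<noteq> \<infinity>"
    unfolding B_def using emeasure_lborel_ball_finite by (metis less_irrefl)
  moreover have "emeasure lborel B \<noteq> 0"
  proof
    assume "emeasure lborel B = 0"
    then have "negligible B"
      unfolding negligible_iff_null_sets by (intro null_sets_completionI) (simp add: null_sets_def)
    then show False
      by (metis B_def open_ball open_not_negligible centre_in_ball empty_iff zero_less_one)
  qed
  ultimately show "emeasure (distr lborel borel f) A = emeasure lborel A"
    by (metis ennreal_mult_divide_eq infinity_ennreal_def)
qed simp

lemma integral_lborel_orthogonal_transformation:
  fixes f :: "'a::euclidean_space \<Rightarrow> 'a" and g :: "'a \<Rightarrow> complex"
  assumes f: "orthogonal_transformation f" and g: "g \<in> borel_measurable borel"
  shows "(LINT x|lborel. g (f x)) = (LINT x|lborel. g x)"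
proof -
  have "f \<in> borel_measurable borel"
    using orthogonal_transformation_linear [OF f] by (intro borel_measurable_continuous_onI linear_continuous_on)
      (simp add: linear_conv_bounded_linear)
  then have "(LINT x|lborel. g (f x)) = (LINT x|distr lborel borel f. g x)"
    using g by (subst integral_distr) auto
  then show ?thesis using f by (simp add: distr_lborel_orthogonal_transformation)
qed

lemma integral_lborel_translation:
  fixes g :: "'a::euclidean_space \<Rightarrow> complex"
  assumes g: "g \<in> borel_measurable borel"
  shows "(LINT x|lborel. g (x + t)) = (LINT x|lborel. g x)"
proof -
  have "(LINT x|lborel. g x) = (LINT x|distr lborel borel ((+) t). g x)"
    by (simp only: lborel_distr_plus)
  also have "\<dots> = (LINT x|lborel. g (t + x))"
    using g by (subst integral_distr) auto
  finally show ?thesis by (simp add: add.commute)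
qed

lemma integrable_lborel_bounded_support:
  fixes g :: "'a::euclidean_space \<Rightarrow> complex"
  assumes g: "g \<in> borel_measurable borel"
    and bound: "\<And>x. norm (g x) \<le> B" and supp: "\<And>x. g x \<noteq> 0 \<Longrightarrow> norm x \<le> M"
  shows "integrable lborel g"
proof (rule Bochner_Integration.integrable_bound)
  show "integrable lborel (\<lambda>x. B * indicator (cball (0::'a) M) x :: real)"
    by (intro integrable_mult_right integrable_real_indicator emeasure_lborel_cball_finite) auto
  show "g \<in> borel_measurable lborel" using g by simp
  have "0 \<le> B" using bound norm_ge_zero order_trans by blast
  then have "norm (g x) \<le> norm (B * indicator (cball 0 M) x :: real)" for x
    using bound [of x] supp [of x] by (cases "g x = 0") (auto simp: indicator_def)
  then show "AE x in lborel. norm (g x) \<le> norm (B * indicator (cball 0 M) x :: real)" by simp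
qed

section \<open>Weyl groups\<close>

lemma coroot_orthogonal_transformation:
  assumes "orthogonal_transformation f"
  shows "coroot (f \<alpha>) = f (coroot \<alpha>)"
  using assms by (simp add: coroot_def orthogonal_transformation_def linear_cmul)

lemma orthogonal_transformation_root_reflection:
  "orthogonal_transformation (root_reflection \<alpha>)"
proof -
  have "linear (root_reflection \<alpha>)"
    by (rule linearI) (simp_all add: root_reflection_def inner_add_left algebra_simps)
  moreover have "root_reflection \<alpha> x \<bullet> root_reflection \<alpha> y = x \<bullet> y" for x y
    \<comment> \<open>For \<alpha> = 0 division by zero makes \<open>coroot\<close> vanish, so the
      reflection is the identity.\<close>
    by (cases "\<alpha> = 0")
      (simp_all add: root_reflection_def coroot_def inner_diff_left inner_diff_right inner_commute field_simps)
  ultimately show ?thesis by (simp add: orthogonal_transformation_def)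
qed

lemma root_reflection_involution [simp]: "root_reflection \<alpha> (root_reflection \<alpha> x) = x"
  by (cases "\<alpha> = 0")
    (simp_all add: root_reflection_def coroot_def inner_diff_left field_simps)

lemma root_reflection_self:
  "\<alpha> \<noteq> 0 \<Longrightarrow> root_reflection \<alpha> \<alpha> = - \<alpha>"
  by (simp add: root_reflection_def coroot_def scaleR_2)

text \<open>\<open>f\<close> preserves inner products, so the coefficients agree; this is the
  conjugation rule for reflections, written without the inverse of \<open>f\<close>.\<close>

lemma root_reflection_conjugate:
  assumes f: "orthogonal_transformation f"
  shows "root_reflection (f \<alpha>) (f x) = f (root_reflection \<alpha> x)"
  using f by (simp add: root_reflection_def coroot_orthogonal_transformation [OF f])
    (simp add: orthogonal_transformation_def linear_diff linear_cmul)

text \<open>Words supply a length for inductions; they need not be reduced.\<close>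

primrec refl_word :: "'a::euclidean_space list \<Rightarrow> 'a \<Rightarrow> 'a" where
  "refl_word [] = id"
| "refl_word (\<alpha> # as) = root_reflection \<alpha> \<circ> refl_word as"

lemma refl_word_append: "refl_word (as @ bs) = refl_word as \<circ> refl_word bs"
  by (induction as) auto

lemma refl_word_rev: "refl_word (rev as) (refl_word as x) = x"
  by (induction as arbitrary: x) (auto simp: refl_word_append)

lemma orthogonal_transformation_refl_word: "orthogonal_transformation (refl_word as)"
proof (induction as)
  case (Cons \<alpha> as)
  then show ?case
    using orthogonal_transformation_compose [OF orthogonal_transformation_root_reflection]
    by (simp del: comp_apply)
qed (simp add: id_def)

text \<open>Reflections are involutions, so inverses in the generated group add nothing to products
  of generators.\<close>

lemma weyl_group_eq_refl_words: "weyl_group \<Delta> = refl_word ` lists \<Delta>"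
proof -
  let ?G = "BijGroup (UNIV :: 'a set)"
  interpret G: group ?G by (rule group_BijGroup)
  have carrier: "f \<in> carrier ?G \<longleftrightarrow> bij f" for f :: "'a \<Rightarrow> 'a"
    by (simp add: BijGroup_def Bij_def)
  \<comment> \<open>\<open>compose\<close> restricts to the underlying set, which is
    \<open>UNIV\<close> here, so the product is ordinary composition.\<close>
  have mult: "f \<otimes>\<^bsub>?G\<^esub> g = f \<circ> g" if "bij f" "bij g" for f g :: "'a \<Rightarrow> 'a"
    using that by (auto simp: BijGroup_def Bij_def compose_def fun_eq_iff)
  have one: "\<one>\<^bsub>?G\<^esub> = id" by (simp add: BijGroup_def fun_eq_iff)
  have bij: "bij (refl_word as)" for as :: "'a list"
    by (rule orthogonal_transformation_bij [OF orthogonal_transformation_refl_word])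
  have bij_refl: "bij (root_reflection \<alpha>)" for \<alpha> :: 'a
    by (rule orthogonal_transformation_bij [OF orthogonal_transformation_root_reflection])
  have inv: "inv\<^bsub>?G\<^esub> root_reflection \<alpha> = root_reflection \<alpha>" for \<alpha> :: 'a
    by (rule G.inv_equality) (auto simp: carrier mult one bij_refl fun_eq_iff)
  show ?thesis
  proof (intro equalityI subsetI)
    fix w assume "w \<in> weyl_group \<Delta>"
    then show "w \<in> refl_word ` lists \<Delta>"
      unfolding weyl_group_def
    proof (induction rule: generate.induct)
      case one
      show ?case by (intro image_eqI [of _ _ "[]"]) (auto simp: \<open>\<one>\<^bsub>?G\<^esub> = id\<close>)
    next
      case (incl h)
      then obtain \<alpha> where "h = root_reflection \<alpha>" "\<alpha> \<in> \<Delta>" by auto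
      then show ?case by (intro image_eqI [of _ _ "[\<alpha>]"]) auto
    next
      case (inv h)
      then obtain \<alpha> where "h = root_reflection \<alpha>" "\<alpha> \<in> \<Delta>" by auto
      then show ?case
        by (intro image_eqI [of _ _ "[\<alpha>]"]) (auto simp: \<open>\<And>\<alpha>. inv\<^bsub>?G\<^esub> root_reflection \<alpha> = root_reflection \<alpha>\<close>)
    next
      case (eng h1 h2)
      then obtain as bs where "h1 = refl_word as" "h2 = refl_word bs" "as \<in> lists \<Delta>" "bs \<in> lists \<Delta>"
        by auto
      then show ?case by (intro image_eqI [of _ _ "as @ bs"]) (auto simp: mult bij refl_word_append)
    qed
  next
    fix w assume "w \<in> refl_word ` lists \<Delta>"
    then obtain as where as: "as \<in> lists \<Delta>" and w: "w = refl_word as" by auto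
    from as have "refl_word as \<in> generate ?G (root_reflection ` \<Delta>)"
    proof (induction rule: lists.induct)
      case Nil
      show ?case using generate.one [of ?G] by (simp add: one id_def)
    next
      case (Cons \<alpha> as)
      then show ?case
        using generate.eng [OF generate.incl [of "root_reflection \<alpha>"] Cons.IH]
        by (simp add: mult bij bij_refl del: comp_apply)
    qed
    then show "w \<in> weyl_group \<Delta>" by (simp add: w weyl_group_def)
  qed
qed

section \<open>Root systems with a base and their Weyl groups\<close>

locale based_root_system =
  fixes R \<Delta> :: "'a::euclidean_space set"
  assumes root_system: "root_system R" and crystallographic: "crystallographic R"
    and reduced: "reduced R" and simple_roots: "simple_roots R \<Delta>"
begin

abbreviation W where "W \<equiv> weyl_group \<Delta>"

lemma finite_roots: "finite R" and root_nonzero: "\<beta> \<in> R \<Longrightarrow> \<beta> \<noteq> 0"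
  and reflection_root: "\<alpha> \<in> R \<Longrightarrow> \<beta> \<in> R \<Longrightarrow> root_reflection \<alpha> \<beta> \<in> R"
  using root_system unfolding root_system_def by blast+

lemma simple_root: "\<alpha> \<in> \<Delta> \<Longrightarrow> \<alpha> \<in> R" and independent_simple: "independent \<Delta>"
  and span_simple: "span \<Delta> = UNIV"
  and pos_or_neg: "\<beta> \<in> R \<Longrightarrow> \<beta> \<in> nonneg_combinations \<Delta> \<or> - \<beta> \<in> nonneg_combinations \<Delta>"
  using simple_roots unfolding simple_roots_def by blast+

lemma finite_simple: "finite \<Delta>"
  using finite_roots simple_root by (meson finite_subset subsetI)

lemma weyl_id: "id \<in> W"
  and weyl_reflection: "\<alpha> \<in> \<Delta> \<Longrightarrow> root_reflection \<alpha> \<in> W"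
  and weyl_compose: "u \<in> W \<Longrightarrow> w \<in> W \<Longrightarrow> u \<circ> w \<in> W"
  and weyl_orthogonal: "w \<in> W \<Longrightarrow> orthogonal_transformation w"
proof -
  show "id \<in> W"
    unfolding weyl_group_eq_refl_words by (intro image_eqI [of _ _ "[]"]) auto
  show "root_reflection \<alpha> \<in> W" if "\<alpha> \<in> \<Delta>"
    unfolding weyl_group_eq_refl_words using that by (intro image_eqI [of _ _ "[\<alpha>]"]) auto
  show "u \<circ> w \<in> W" if uw: "u \<in> W" "w \<in> W"
  proof -
    obtain as bs where "u = refl_word as" "w = refl_word bs" "as \<in> lists \<Delta>" "bs \<in> lists \<Delta>"
      using uw unfolding weyl_group_eq_refl_words by auto
    then show ?thesis
      unfolding weyl_group_eq_refl_words
      by (intro image_eqI [of _ _ "as @ bs"]) (auto simp: refl_word_append)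
  qed
  show "orthogonal_transformation w" if "w \<in> W"
    using that unfolding weyl_group_eq_refl_words by (auto simp: orthogonal_transformation_refl_word)
qed

lemma weyl_inverse:
  assumes "w \<in> W"
  obtains u where "u \<in> W" "\<And>x. u (w x) = x" "\<And>x. w (u x) = x"
proof -
  obtain as where "w = refl_word as" "as \<in> lists \<Delta>"
    using assms unfolding weyl_group_eq_refl_words by auto
  then show ?thesis
    using refl_word_rev [of as] refl_word_rev [of "rev as"]
    by (intro that [of "refl_word (rev as)"]) (auto simp: weyl_group_eq_refl_words)
qed

lemma weyl_bij: "w \<in> W \<Longrightarrow> bij w"
  by (simp add: weyl_orthogonal orthogonal_transformation_bij)

lemma weyl_add: "w \<in> W \<Longrightarrow> w (x + y) = w x + w y"
  and weyl_diff: "w \<in> W \<Longrightarrow> w (x - y) = w x - w y"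
  and weyl_inner: "w \<in> W \<Longrightarrow> w x \<bullet> w y = x \<bullet> y"
  and weyl_norm: "w \<in> W \<Longrightarrow> norm (w x) = norm x"
  using weyl_orthogonal [of w]
  by (auto simp: orthogonal_transformation_def linear_add linear_diff
      orthogonal_transformation_norm norm_eq_sqrt_inner)

lemma refl_word_root: "as \<in> lists \<Delta> \<Longrightarrow> \<beta> \<in> R \<Longrightarrow> refl_word as \<beta> \<in> R"
  by (induction as) (auto intro: reflection_root simple_root)

lemma weyl_root: "w \<in> W \<Longrightarrow> \<beta> \<in> R \<Longrightarrow> w \<beta> \<in> R"
  unfolding weyl_group_eq_refl_words using refl_word_root by auto

text \<open>\<open>R\<close> spans the space and \<open>W\<close> maps it into itself, so an element
  of \<open>W\<close> is determined by a self-map of a finite set.\<close>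

lemma finite_weyl: "finite W"
proof (rule inj_on_finite)
  show "inj_on (\<lambda>w. restrict w R) W"
  proof (rule inj_onI)
    fix u w assume uw: "u \<in> W" "w \<in> W" "restrict u R = restrict w R"
    have "u x = w x" for x
    proof (rule linear_eq_on_span [of u w R])
      show "x \<in> span R" using root_system by (simp add: root_system_def)
      show "u x = w x" if "x \<in> R" for x using uw(3) that by (metis restrict_apply')
    qed (use uw weyl_orthogonal in \<open>auto simp: orthogonal_transformation_linear\<close>)
    then show "u = w" by blast
  qed
  show "(\<lambda>w. restrict w R) ` W \<subseteq> PiE R (\<lambda>_. R)"
    using weyl_root by auto
  show "finite (PiE R (\<lambda>_. R))" using finite_roots by (simp add: finite_PiE)
qed

section \<open>Positive roots and the exchange property\<close>

lemma nonneg_combination_inner: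
  assumes "\<beta> \<in> nonneg_combinations \<Delta>" and "\<And>\<alpha>. \<alpha> \<in> \<Delta> \<Longrightarrow> 0 \<le> x \<bullet> \<alpha>"
  shows "0 \<le> x \<bullet> \<beta>"
  using assms by (auto simp: nonneg_combinations_def inner_sum_right intro!: sum_nonneg)

lemma nonneg_combination_inner_pos:
  assumes "\<beta> \<in> nonneg_combinations \<Delta>" and "\<beta> \<noteq> 0" and x: "\<And>\<alpha>. \<alpha> \<in> \<Delta> \<Longrightarrow> 0 < x \<bullet> \<alpha>"
  shows "0 < x \<bullet> \<beta>"
proof -
  obtain c :: "'a \<Rightarrow> nat" where c: "\<beta> = (\<Sum>\<alpha>\<in>\<Delta>. real (c \<alpha>) *\<^sub>R \<alpha>)"
    using assms by (auto simp: nonneg_combinations_def)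
  have "\<exists>\<gamma>\<in>\<Delta>. real (c \<gamma>) *\<^sub>R \<gamma> \<noteq> 0"
    using \<open>\<beta> \<noteq> 0\<close> unfolding c by (meson sum.neutral)
  then obtain \<gamma> where "\<gamma> \<in> \<Delta>" "c \<gamma> > 0" by (auto intro: gr0I)
  then have "0 < (\<Sum>\<alpha>\<in>\<Delta>. real (c \<alpha>) * (x \<bullet> \<alpha>))"
    using x by (intro sum_pos2 [OF finite_simple]) (auto simp: less_imp_le)
  then show ?thesis by (simp add: c inner_sum_right)
qed

text \<open>The inner product with \<rho> is the height, the sum of the coefficients in the basis of
  simple roots; it serves to separate positive from negative roots.\<close>

lemma exists_height: "\<exists>\<rho>. \<forall>\<alpha>\<in>\<Delta>. \<alpha> \<bullet> \<rho> = 1"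
proof -
  obtain g :: "'a \<Rightarrow> real" where g: "linear g" "\<And>\<alpha>. \<alpha> \<in> \<Delta> \<Longrightarrow> g \<alpha> = 1"
    using linear_independent_extend [OF independent_simple, of "\<lambda>_. 1"] by auto
  \<comment> \<open>The adjoint of a functional, evaluated at 1, is the vector that represents
    it.\<close>
  then have "\<alpha> \<bullet> adjoint g 1 = 1" if "\<alpha> \<in> \<Delta>" for \<alpha>
    using that by (simp add: adjoint_works)
  then show ?thesis by blast
qed

text \<open>The reflection changes only the coefficient of \<alpha>. A positive root whose other
  coefficients all vanish is a multiple of \<alpha>, hence \<alpha> itself since \<open>R\<close> is
  reduced.\<close>

lemma simple_reflection_pos:
  assumes \<alpha>: "\<alpha> \<in> \<Delta>" and \<beta>: "\<beta> \<in> R" "\<beta> \<in> nonneg_combinations \<Delta>" and "\<beta> \<noteq> \<alpha>"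
  shows "root_reflection \<alpha> \<beta> \<in> nonneg_combinations \<Delta>"
proof (rule ccontr)
  assume "root_reflection \<alpha> \<beta> \<notin> nonneg_combinations \<Delta>"
  then have "- root_reflection \<alpha> \<beta> \<in> nonneg_combinations \<Delta>"
    using pos_or_neg reflection_root \<alpha> \<beta> simple_root by blast
  then obtain d :: "'a \<Rightarrow> nat" where d: "- root_reflection \<alpha> \<beta> = (\<Sum>\<gamma>\<in>\<Delta>. real (d \<gamma>) *\<^sub>R \<gamma>)"
    by (auto simp: nonneg_combinations_def)
  obtain c :: "'a \<Rightarrow> nat" where c: "\<beta> = (\<Sum>\<gamma>\<in>\<Delta>. real (c \<gamma>) *\<^sub>R \<gamma>)"
    using \<beta> by (auto simp: nonneg_combinations_def)
  \<comment> \<open>Coefficients of the identity that \<beta> minus its reflection is a multiple of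
    \<alpha>; independence makes all of them zero.\<close>
  let ?e = "\<lambda>\<gamma>. real (c \<gamma>) + real (d \<gamma>) - (if \<gamma> = \<alpha> then \<beta> \<bullet> coroot \<alpha> else 0)"
  have "(\<Sum>\<gamma>\<in>\<Delta>. (if \<gamma> = \<alpha> then \<beta> \<bullet> coroot \<alpha> else 0) *\<^sub>R \<gamma>) = (\<beta> \<bullet> coroot \<alpha>) *\<^sub>R \<alpha>"
    using \<alpha> finite_simple by (simp add: if_distrib [of "\<lambda>r. r *\<^sub>R _"] cong: if_cong)
  then have "(\<Sum>\<gamma>\<in>\<Delta>. ?e \<gamma> *\<^sub>R \<gamma>) = \<beta> + - root_reflection \<alpha> \<beta> - (\<beta> \<bullet> coroot \<alpha>) *\<^sub>R \<alpha>"
    unfolding d by (subst c) (simp add: scaleR_add_left scaleR_diff_left sum.distrib sum_subtractf)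
  also have "\<dots> = 0" by (simp add: root_reflection_def)
  finally have e0: "(\<Sum>\<gamma>\<in>\<Delta>. ?e \<gamma> *\<^sub>R \<gamma>) = 0" .
  have "\<forall>e. (\<Sum>\<gamma>\<in>\<Delta>. e \<gamma> *\<^sub>R \<gamma>) = 0 \<longrightarrow> (\<forall>\<gamma>\<in>\<Delta>. e \<gamma> = 0)"
    using independent_simple by (simp add: independent_explicit)
  then have "\<forall>\<gamma>\<in>\<Delta>. ?e \<gamma> = 0" using e0 by (elim allE [where x = ?e]) (erule mp)
  then have "c \<gamma> = 0" if "\<gamma> \<in> \<Delta> - {\<alpha>}" for \<gamma> 
    using that by (smt (verit) DiffE of_nat_0_le_iff of_nat_eq_0_iff singletonI)
  then have "(\<Sum>\<gamma>\<in>\<Delta> - {\<alpha>}. real (c \<gamma>) *\<^sub>R \<gamma>) = 0" by (intro sum.neutral) auto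
  then have "\<beta> = real (c \<alpha>) *\<^sub>R \<alpha>"
    using c \<alpha> finite_simple by (simp add: sum.remove [of \<Delta> \<alpha>])
  then have "real (c \<alpha>) = 1"
    using reduced \<alpha> \<beta>(1) simple_root unfolding reduced_def
    by (metis of_nat_0_le_iff neg_0_le_iff_le not_one_le_zero)
  with \<open>\<beta> = real (c \<alpha>) *\<^sub>R \<alpha>\<close> \<open>\<beta> \<noteq> \<alpha>\<close> show False by simp
qed

text \<open>A root of both signs would have positive and negative height.\<close>

lemma not_pos_and_neg:
  assumes "\<beta> \<in> R" "\<beta> \<in> nonneg_combinations \<Delta>" shows "- \<beta> \<notin> nonneg_combinations \<Delta>"
proof
  assume "- \<beta> \<in> nonneg_combinations \<Delta>"
  obtain \<rho> where "\<And>\<alpha>. \<alpha> \<in> \<Delta> \<Longrightarrow> \<alpha> \<bullet> \<rho> = 1" using exists_height by metis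
  then have \<rho>: "\<And>\<alpha>. \<alpha> \<in> \<Delta> \<Longrightarrow> 0 < \<rho> \<bullet> \<alpha>" by (simp add: inner_commute)
  have "\<beta> \<noteq> 0" "- \<beta> \<noteq> 0" using root_nonzero assms(1) by auto
  then have "0 < \<rho> \<bullet> \<beta>" "0 < \<rho> \<bullet> - \<beta>"
    using nonneg_combination_inner_pos [OF assms(2) _ \<rho>]
      nonneg_combination_inner_pos [OF \<open>- \<beta> \<in> nonneg_combinations \<Delta>\<close> _ \<rho>] by blast+
  then show False by simp
qed

text \<open>Induction on the height: unless \<beta> is simple, reflecting it in a simple root that
  makes an acute angle with it yields a positive root of smaller height.\<close>

lemma pos_root_conjugate_simple:
  assumes "\<beta> \<in> R" and "\<beta> \<in> nonneg_combinations \<Delta>"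
  shows "\<exists>w\<in>W. \<exists>\<alpha>\<in>\<Delta>. \<beta> = w \<alpha>"
proof -
  obtain \<rho> where \<rho>: "\<And>\<alpha>. \<alpha> \<in> \<Delta> \<Longrightarrow> \<alpha> \<bullet> \<rho> = 1" using exists_height by metis
  have height: "\<exists>n. real n = \<beta> \<bullet> \<rho>" if pos: "\<beta> \<in> nonneg_combinations \<Delta>" for \<beta>
  proof -
    obtain c :: "'a \<Rightarrow> nat" where c: "\<beta> = (\<Sum>\<alpha>\<in>\<Delta>. real (c \<alpha>) *\<^sub>R \<alpha>)"
      using pos by (auto simp: nonneg_combinations_def)
    have "\<beta> \<bullet> \<rho> = real (\<Sum>\<alpha>\<in>\<Delta>. c \<alpha>)"
      by (simp add: c inner_sum_left \<rho>)
    then show ?thesis by metis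
  qed
  obtain n where "real n = \<beta> \<bullet> \<rho>" using height [OF assms(2)] by auto
  then show ?thesis
    using assms
  proof (induction n arbitrary: \<beta> rule: less_induct)
    case (less n)
    have "\<exists>\<alpha>\<in>\<Delta>. 0 < \<beta> \<bullet> \<alpha>"
    proof (rule ccontr)
      assume "\<not> ?thesis"
      \<comment> \<open>Here - \<beta> has nonnegative inner product with every simple root, hence
        with the positive root \<beta>.\<close>
      then have "0 \<le> (- \<beta>) \<bullet> \<beta>"
        using less.prems by - (rule nonneg_combination_inner, auto simp: not_less)
      then show False using root_nonzero [OF less.prems(2)] 
        by (metis inner_ge_zero inner_minus_left inner_eq_zero_iff neg_0_le_iff_le order_antisym)
    qed
    then obtain \<alpha> where \<alpha>: "\<alpha> \<in> \<Delta>" "0 < \<beta> \<bullet> \<alpha>" by blast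
    show ?case
    proof (cases "\<beta> = \<alpha>")
      case True
      then show ?thesis using \<alpha> weyl_id by (metis id_apply)
    next
      case False
      let ?\<gamma> = "root_reflection \<alpha> \<beta>"
      have \<gamma>: "?\<gamma> \<in> R" "?\<gamma> \<in> nonneg_combinations \<Delta>"
        using less.prems \<alpha> False by (auto intro: simple_reflection_pos reflection_root simple_root)
      obtain m where m: "real m = ?\<gamma> \<bullet> \<rho>" using height [OF \<gamma>(2)] by auto
      have "\<alpha> \<noteq> 0" using \<alpha> by auto
      then have "0 < \<beta> \<bullet> coroot \<alpha>" using \<alpha> by (simp add: coroot_def)
      \<comment> \<open>Simple roots have height 1, so the height drops by
        \<open>\<beta> \<bullet> coroot \<alpha>\<close>, which is positive.\<close>
      then have "m < n"
        using m less.prems(1) \<rho> [OF \<alpha>(1)] by (simp add: root_reflection_def inner_diff_left)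
      then obtain w \<gamma> where "w \<in> W" "\<gamma> \<in> \<Delta>" "?\<gamma> = w \<gamma>"
        using less.IH [OF _ m \<gamma>] by auto
      then have "\<beta> = (root_reflection \<alpha> \<circ> w) \<gamma>" "root_reflection \<alpha> \<circ> w \<in> W"
        using \<alpha> by (auto intro: weyl_compose weyl_reflection) (metis root_reflection_involution)
      then show ?thesis using \<open>\<gamma> \<in> \<Delta>\<close> by blast
    qed
  qed
qed

lemma root_reflection_in_weyl:
  assumes "\<beta> \<in> R" "\<beta> \<in> nonneg_combinations \<Delta>" shows "root_reflection \<beta> \<in> W"
proof -
  obtain w \<alpha> where w: "w \<in> W" "\<alpha> \<in> \<Delta>" "\<beta> = w \<alpha>" using pos_root_conjugate_simple assms by blast
  obtain u where u: "u \<in> W" "\<And>x. u (w x) = x" "\<And>x. w (u x) = x" using weyl_inverse w by blast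
  have "root_reflection \<beta> = w \<circ> root_reflection \<alpha> \<circ> u"
  proof
    fix x
    have "root_reflection (w \<alpha>) (w (u x)) = w (root_reflection \<alpha> (u x))"
      by (rule root_reflection_conjugate [OF weyl_orthogonal [OF w(1)]])
    then show "root_reflection \<beta> x = (w \<circ> root_reflection \<alpha> \<circ> u) x" using u w by simp
  qed
  then show ?thesis using w u by (auto intro!: weyl_compose weyl_reflection)
qed

text \<open>Applying the letters from the right, some letter turns the image of \<alpha> negative.
  The image just before equals that letter, so its reflection cancels against the appended
  reflection in \<alpha>.\<close>

lemma exchange:
  assumes "as \<in> lists \<Delta>" "\<alpha> \<in> \<Delta>" "- refl_word as \<alpha> \<in> nonneg_combinations \<Delta>"
  shows "\<exists>bs\<in>lists \<Delta>. length bs < length as \<and> refl_word as \<circ> root_reflection \<alpha> = refl_word bs"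
  using assms
proof (induction as)
  case Nil
  have "\<alpha> \<in> nonneg_combinations \<Delta>"
    unfolding nonneg_combinations_def mem_Collect_eq
    using \<open>\<alpha> \<in> \<Delta>\<close> finite_simple
    by (intro exI [of _ "\<lambda>\<gamma>. if \<gamma> = \<alpha> then 1 else 0"])
      (simp add: if_distrib [of real] if_distrib [of "\<lambda>r. r *\<^sub>R _"] cong: if_cong)
  then show ?case using Nil not_pos_and_neg simple_root by auto
next
  case (Cons a as)
  let ?w = "refl_word as"
  have as: "as \<in> lists \<Delta>" "a \<in> \<Delta>" using Cons.hyps by simp_all
  have root: "?w \<alpha> \<in> R" using refl_word_root as Cons.prems simple_root by blast
  show ?case
  proof (cases "- ?w \<alpha> \<in> nonneg_combinations \<Delta>")
    case True
    then obtain bs where "bs \<in> lists \<Delta>" "length bs < length as"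
      "?w \<circ> root_reflection \<alpha> = refl_word bs"
      using Cons.IH as Cons.prems by blast
    then show ?thesis using as by (intro bexI [of _ "a # bs"]) (auto simp: fun_eq_iff)
  next
    case False
    then have "?w \<alpha> \<in> nonneg_combinations \<Delta>" using pos_or_neg root by blast
    moreover have "root_reflection a (?w \<alpha>) \<notin> nonneg_combinations \<Delta>"
      using Cons.prems not_pos_and_neg reflection_root root as simple_root by auto
    \<comment> \<open>\<open>a\<close> is the only positive root that its own reflection makes
      negative.\<close>
    ultimately have "?w \<alpha> = a" using simple_reflection_pos as root by blast
    then have "root_reflection a (?w x) = ?w (root_reflection \<alpha> x)" for x
      using root_reflection_conjugate [OF orthogonal_transformation_refl_word, of as \<alpha> x] by simp
    then have "(\<lambda>x. root_reflection a (?w (root_reflection \<alpha> x))) = ?w" by (auto simp: fun_eq_iff)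
    then show ?thesis using as by (intro bexI [of _ as]) (simp_all add: comp_def)
  qed
qed

text \<open>Induction on the length: \<open>exchange\<close> replaces a nonempty word by a shorter
  one with the same image of \<open>x\<close>.\<close>

lemma dominant_orbit_unique:
  assumes "as \<in> lists \<Delta>" "x \<in> dominant_chamber \<Delta>" "refl_word as x \<in> dominant_chamber \<Delta>"
  shows "refl_word as x = x"
  using assms
proof (induction "length as" arbitrary: as rule: less_induct)
  case less
  show ?case
  proof (cases "\<exists>\<alpha>\<in>\<Delta>. - refl_word as \<alpha> \<in> nonneg_combinations \<Delta>")
    case True
    then obtain \<alpha> where \<alpha>: "\<alpha> \<in> \<Delta>" "- refl_word as \<alpha> \<in> nonneg_combinations \<Delta>" by blast
    obtain bs where bs: "bs \<in> lists \<Delta>" "length bs < length as"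
      "refl_word as \<circ> root_reflection \<alpha> = refl_word bs"
      using exchange less.prems(1) \<alpha> by blast
    \<comment> \<open>Pairing the dominant image with a positive root and pulling back gives
      \<open>x \<bullet> \<alpha> \<le> 0\<close>, so \<open>x\<close> lies on the wall of
      \<alpha>.\<close>
    have "0 \<le> refl_word as x \<bullet> - refl_word as \<alpha>"
      using less.prems \<alpha> by - (rule nonneg_combination_inner, auto simp: dominant_chamber_def)
    also have "\<dots> = - (x \<bullet> \<alpha>)"
      using orthogonal_transformation_refl_word [of as] by (simp add: orthogonal_transformation_def)
    finally have "x \<bullet> \<alpha> = 0" using less.prems \<alpha> by (force simp: dominant_chamber_def)
    then have "root_reflection \<alpha> x = x" by (simp add: root_reflection_def coroot_def)
    then have "refl_word bs x = refl_word as x" by (metis bs(3) comp_apply)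
    then show ?thesis using less.hyps [OF bs(2,1)] less.prems by simp
  next
    case False
    show ?thesis
    proof (cases as rule: rev_cases)
      case (snoc as' \<alpha>)
      have \<alpha>: "\<alpha> \<in> \<Delta>" "as' \<in> lists \<Delta>" using snoc less.prems(1) by simp_all
      have "refl_word as \<alpha> \<in> R" using less.prems \<alpha> refl_word_root simple_root by blast
      then have "refl_word as \<alpha> \<in> nonneg_combinations \<Delta>" using False pos_or_neg \<alpha> by blast
      \<comment> \<open>The last letter negates \<alpha>, so \<open>as'\<close> sends \<alpha> to a
        negative root and \<open>exchange\<close> shortens the word without changing the
        map.\<close>
      moreover have "refl_word as \<alpha> = - refl_word as' \<alpha>"
        using \<alpha> simple_root root_nonzero orthogonal_transformation_refl_word [of as']
        by (simp add: snoc refl_word_append root_reflection_self linear_neg orthogonal_transformation_linear)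
      ultimately obtain bs where "bs \<in> lists \<Delta>" "length bs < length as'"
        "refl_word as' \<circ> root_reflection \<alpha> = refl_word bs"
        using exchange \<alpha> by metis
      moreover have "refl_word as' \<circ> root_reflection \<alpha> = refl_word as"
        by (simp add: snoc refl_word_append)
      ultimately show ?thesis using less.hyps [of bs] less.prems snoc by simp
    qed simp
  qed
qed

end

section \<open>The fundamental simplex and its images\<close>

locale affine_root_system = based_root_system +
  fixes \<xi> :: 'a
  assumes highest_root: "highest_root R \<Delta> \<xi>"
begin

abbreviation F where "F \<equiv> fundamental_simplex \<Delta> \<xi>"

text \<open>The dual of the weight lattice, that is, the coroot lattice; the proof only needs that it
  contains the positive coroots.\<close>

definition translation_lattice :: "'a set" where
  "translation_lattice = {q. \<forall>\<mu>\<in>weight_lattice \<Delta>. \<mu> \<bullet> q \<in> \<int>}"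

lemma highest: "\<xi> \<in> R" "\<beta> \<in> R \<Longrightarrow> \<xi> - \<beta> \<in> nonneg_combinations \<Delta>"
  using highest_root by (auto simp: highest_root_def)

section \<open>Weights and translations under the Weyl group\<close>

lemma root_weight: "\<beta> \<in> R \<Longrightarrow> \<beta> \<in> weight_lattice \<Delta>"
  using crystallographic simple_root by (auto simp: weight_lattice_def crystallographic_def)

lemma weight_diff: "\<mu> \<in> weight_lattice \<Delta> \<Longrightarrow> \<nu> \<in> weight_lattice \<Delta> \<Longrightarrow> \<mu> - \<nu> \<in> weight_lattice \<Delta>"
  by (auto simp: weight_lattice_def inner_diff_left)

lemma refl_word_weight:
  "as \<in> lists \<Delta> \<Longrightarrow> \<mu> \<in> weight_lattice \<Delta> \<Longrightarrow> refl_word as \<mu> \<in> weight_lattice \<Delta>"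
proof (induction as)
  case (Cons a as)
  then have *: "refl_word as \<mu> \<in> weight_lattice \<Delta>" by auto
  moreover have "a \<in> weight_lattice \<Delta>" using Cons.prems by (auto intro: root_weight simple_root)
  ultimately show ?case
    using Cons.prems by (auto simp: weight_lattice_def root_reflection_def inner_diff_left)
qed simp

lemma weyl_weight: "w \<in> W \<Longrightarrow> \<mu> \<in> weight_lattice \<Delta> \<Longrightarrow> w \<mu> \<in> weight_lattice \<Delta>"
  unfolding weyl_group_eq_refl_words using refl_word_weight by auto

lemma translation_0: "0 \<in> translation_lattice"
  and translation_add: "p \<in> translation_lattice \<Longrightarrow> q \<in> translation_lattice \<Longrightarrow> p + q \<in> translation_lattice"
  and translation_diff: "p \<in> translation_lattice \<Longrightarrow> q \<in> translation_lattice \<Longrightarrow> p - q \<in> translation_lattice"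
  and translation_minus: "q \<in> translation_lattice \<Longrightarrow> - q \<in> translation_lattice"
  by (auto simp: translation_lattice_def inner_add_right inner_diff_right)

lemma weyl_translation:
  assumes "w \<in> W" "q \<in> translation_lattice" shows "w q \<in> translation_lattice"
  unfolding translation_lattice_def
proof (intro CollectI ballI)
  fix \<mu> assume \<mu>: "\<mu> \<in> weight_lattice \<Delta>"
  obtain u where u: "u \<in> W" "\<And>x. u (w x) = x" "\<And>x. w (u x) = x" using weyl_inverse assms by blast
  have "\<mu> \<bullet> w q = u \<mu> \<bullet> q" using weyl_inner [OF assms(1), of "u \<mu>" q] u by simp
  then show "\<mu> \<bullet> w q \<in> \<int>" using weyl_weight [OF u(1) \<mu>] assms(2) by (simp add: translation_lattice_def)
qed

text \<open>For a simple root this is the definition of a weight; every positive root is conjugate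
  to a simple one under \<open>W\<close>.\<close>

lemma coroot_translation:
  assumes "\<beta> \<in> R" "\<beta> \<in> nonneg_combinations \<Delta>" shows "coroot \<beta> \<in> translation_lattice"
proof -
  obtain w \<alpha> where w: "w \<in> W" "\<alpha> \<in> \<Delta>" "\<beta> = w \<alpha>" using pos_root_conjugate_simple assms by blast
  have "coroot \<alpha> \<in> translation_lattice" using w by (auto simp: translation_lattice_def weight_lattice_def)
  then show ?thesis using w weyl_translation by (simp add: coroot_orthogonal_transformation weyl_orthogonal)
qed

lemma root_inner_translation: "\<beta> \<in> R \<Longrightarrow> q \<in> translation_lattice \<Longrightarrow> q \<bullet> \<beta> \<in> \<int>"
  using root_weight by (auto simp: translation_lattice_def inner_commute)

lemma eq_by_simple_inner:
  assumes "\<And>\<alpha>. \<alpha> \<in> \<Delta> \<Longrightarrow> p \<bullet> \<alpha> = q \<bullet> \<alpha>" shows "p = q"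
proof -
  have "(p - q) \<bullet> x = 0" if "x \<in> span \<Delta>" for x
    using that by (induction rule: span_induct_alt) (auto simp: inner_diff_left inner_add_right assms)
  then have "(p - q) \<bullet> (p - q) = 0" using span_simple by blast
  then show ?thesis by simp
qed

text \<open>A translation is determined by its inner products with the simple roots; these are
  integers, bounded by Cauchy-Schwarz.\<close>

lemma finite_translations: "finite {q \<in> translation_lattice. norm q \<le> M}"
proof (rule inj_on_finite)
  show "inj_on (\<lambda>q. restrict (\<lambda>\<alpha>. q \<bullet> \<alpha>) \<Delta>) {q \<in> translation_lattice. norm q \<le> M}"
    by (rule inj_onI) (metis (no_types, lifting) eq_by_simple_inner restrict_apply')
  show "(\<lambda>q. restrict (\<lambda>\<alpha>. q \<bullet> \<alpha>) \<Delta>) ` {q \<in> translation_lattice. norm q \<le> M}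
      \<subseteq> PiE \<Delta> (\<lambda>\<alpha>. {k :: real. k \<in> \<int> \<and> \<bar>k\<bar> \<le> M * norm \<alpha>})"
  proof -
    have "\<bar>q \<bullet> \<alpha>\<bar> \<le> M * norm \<alpha>" if "norm q \<le> M" for q \<alpha> :: 'a
      using that Cauchy_Schwarz_ineq2 [of q \<alpha>] mult_right_mono [OF that, of "norm \<alpha>"] by simp
    then show ?thesis using root_inner_translation simple_root by auto
  qed
  show "finite (PiE \<Delta> (\<lambda>\<alpha>. {k :: real. k \<in> \<int> \<and> \<bar>k\<bar> \<le> M * norm \<alpha>}))"
    using finite_simple by (intro finite_PiE finite_abs_int_segment)
qed

section \<open>Geometry of the fundamental simplex\<close>

lemma highest_pos: "\<xi> \<in> nonneg_combinations \<Delta>"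
proof (rule ccontr)
  assume "\<xi> \<notin> nonneg_combinations \<Delta>"
  then have neg: "- \<xi> \<in> nonneg_combinations \<Delta>" using pos_or_neg highest by blast
  have "- \<xi> \<in> R"
    using reflection_root [OF highest(1) highest(1)] by (simp add: root_reflection_self root_nonzero highest)
  then have "\<xi> - - \<xi> \<in> nonneg_combinations \<Delta>" by (rule highest)
  obtain \<rho> where \<rho>: "\<And>\<alpha>. \<alpha> \<in> \<Delta> \<Longrightarrow> \<rho> \<bullet> \<alpha> = 1" using exists_height by (metis inner_commute)
  \<comment> \<open>If \<xi> were negative, twice \<xi> would have both nonnegative and negative
    height.\<close>
  have "0 \<le> \<rho> \<bullet> (\<xi> - - \<xi>)"
    using \<open>\<xi> - - \<xi> \<in> _\<close> by (rule nonneg_combination_inner) (simp add: \<rho>)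
  moreover have "0 < \<rho> \<bullet> - \<xi>"
    using neg by (rule nonneg_combination_inner_pos) (simp_all add: \<rho> root_nonzero highest)
  ultimately show False by (simp add: inner_add_right)
qed

text \<open>The upper bound holds because \<xi> - \<beta> is a nonnegative combination, so
  \<open>y \<bullet> \<beta> \<le> y \<bullet> \<xi>\<close>.\<close>

lemma simplex_root:
  assumes "y \<in> F" "\<beta> \<in> R" "\<beta> \<in> nonneg_combinations \<Delta>" shows "0 < y \<bullet> \<beta>" "y \<bullet> \<beta> < 1"
proof -
  have y: "\<And>\<alpha>. \<alpha> \<in> \<Delta> \<Longrightarrow> 0 < y \<bullet> \<alpha>" "y \<bullet> \<xi> < 1" using assms by (auto simp: fundamental_simplex_def)
  show "0 < y \<bullet> \<beta>" by (rule nonneg_combination_inner_pos) (use y assms root_nonzero in auto)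
  have "0 \<le> y \<bullet> (\<xi> - \<beta>)"
    by (rule nonneg_combination_inner) (use y highest assms in \<open>auto intro: less_imp_le\<close>)
  then show "y \<bullet> \<beta> < 1" using y by (simp add: inner_diff_right)
qed

text \<open>The floor depends on \<beta> alone and not on \<open>y\<close>: no hyperplane
  \<open>y \<bullet> \<beta> = k\<close> cuts \<open>F\<close>.\<close>

lemma simplex_root_floor:
  assumes "y \<in> F" "\<beta> \<in> R"
  shows "y \<bullet> \<beta> \<notin> \<int>" "\<lfloor>y \<bullet> \<beta>\<rfloor> = (if \<beta> \<in> nonneg_combinations \<Delta> then 0 else - 1)"
proof -
  have "\<lfloor>y \<bullet> \<beta>\<rfloor> = (if \<beta> \<in> nonneg_combinations \<Delta> then 0 else - 1) \<and> y \<bullet> \<beta> \<notin> \<int>"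
  proof (cases "\<beta> \<in> nonneg_combinations \<Delta>")
    case True
    then have b: "0 < y \<bullet> \<beta>" "y \<bullet> \<beta> < 1" using simplex_root assms by auto
    then have "\<lfloor>y \<bullet> \<beta>\<rfloor> = 0" by linarith
    then show ?thesis using b True by (metis less_irrefl of_int_0 of_int_floor)
  next
    case False
    then have neg: "- \<beta> \<in> nonneg_combinations \<Delta>" using assms pos_or_neg by blast
    have "- \<beta> \<in> R"
      using reflection_root [OF assms(2) assms(2)] by (simp add: root_reflection_self root_nonzero assms)
    then have b: "y \<bullet> \<beta> < 0" "- 1 < y \<bullet> \<beta>" using simplex_root [OF assms(1) _ neg] by auto
    then have "\<lfloor>y \<bullet> \<beta>\<rfloor> = - 1" by linarith
    then show ?thesis using b False by (metis less_irrefl of_int_1 of_int_floor of_int_minus)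
  qed
  then show "y \<bullet> \<beta> \<notin> \<int>" "\<lfloor>y \<bullet> \<beta>\<rfloor> = (if \<beta> \<in> nonneg_combinations \<Delta> then 0 else - 1)" by auto
qed

lemma simplex_nonempty: "\<exists>p. p \<in> F"
proof -
  obtain \<rho> where \<rho>: "\<And>\<alpha>. \<alpha> \<in> \<Delta> \<Longrightarrow> \<rho> \<bullet> \<alpha> = 1" using exists_height by (metis inner_commute)
  have pos: "0 < \<rho> \<bullet> \<xi>"
    using highest_pos by (rule nonneg_combination_inner_pos) (simp_all add: \<rho> root_nonzero highest)
  \<comment> \<open>Scaling keeps the inner products with simple roots positive and brings the one
    with \<xi> below 1.\<close>
  then have "(1 / (1 + \<rho> \<bullet> \<xi>)) *\<^sub>R \<rho> \<in> F"
    by (simp add: fundamental_simplex_def \<rho> add_pos_pos)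
  then show ?thesis by blast
qed

text \<open>Inner products with simple roots have modulus at most 1 on \<open>F\<close>. Simple
  roots span, so every linear functional, in particular each coordinate, is bounded on
  \<open>F\<close>.\<close>

lemma simplex_bounded: "\<exists>M. \<forall>y\<in>F. norm y \<le> M"
proof -
  have inner: "\<exists>C. \<forall>y\<in>F. \<bar>y \<bullet> x\<bar> \<le> C" if "x \<in> span \<Delta>" for x
    using that
  proof (induction rule: span_induct_alt)
    case base
    show ?case by (intro exI [of _ 0]) auto
  next
    case (step c \<alpha> x)
    then obtain C where C: "\<And>y. y \<in> F \<Longrightarrow> \<bar>y \<bullet> x\<bar> \<le> C" by auto
    have "\<bar>y \<bullet> (c *\<^sub>R \<alpha> + x)\<bar> \<le> \<bar>c\<bar> + C" if y: "y \<in> F" for y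
    proof -
      have "\<bar>y \<bullet> \<alpha>\<bar> \<le> 1"
        using simplex_root_floor(2) [OF y simple_root [OF step(1)]] by (auto split: if_splits) linarith+
      then have "\<bar>c * (y \<bullet> \<alpha>)\<bar> \<le> \<bar>c\<bar>" by (simp add: abs_mult mult_left_le)
      then show ?thesis using C [OF y] by (simp add: inner_add_right)
    qed
    then show ?case by blast
  qed
  have "\<forall>b. \<exists>C. \<forall>y\<in>F. \<bar>y \<bullet> b\<bar> \<le> C" using inner span_simple by blast
  then obtain C where "\<And>b y. y \<in> F \<Longrightarrow> \<bar>y \<bullet> b\<bar> \<le> C b" by metis
  then have "norm y \<le> (\<Sum>b\<in>Basis. C b)" if "y \<in> F" for y
    using that norm_le_l1 [of y] by (meson order_trans sum_mono)
  then show ?thesis by blast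
qed

lemma open_simplex: "open F"
proof -
  have "F = (\<Inter>\<alpha>\<in>\<Delta>. {y. 0 < y \<bullet> \<alpha>}) \<inter> {y. y \<bullet> \<xi> < 1}"
    by (auto simp: fundamental_simplex_def)
  moreover have "open (\<Inter>\<alpha>\<in>\<Delta>. {y. 0 < y \<bullet> \<alpha>})"
    using finite_simple by (intro open_INT ballI open_Collect_less continuous_intros) auto
  moreover have "open {y. y \<bullet> \<xi> < 1}" by (intro open_Collect_less continuous_intros)
  ultimately show ?thesis by (metis open_Int)
qed

lemma closure_simplex_subset:
  "closure F \<subseteq> {y. (\<forall>\<alpha>\<in>\<Delta>. 0 \<le> y \<bullet> \<alpha>) \<and> y \<bullet> \<xi> \<le> 1}"
proof (rule closure_minimal)
  show "F \<subseteq> {y. (\<forall>\<alpha>\<in>\<Delta>. 0 \<le> y \<bullet> \<alpha>) \<and> y \<bullet> \<xi> \<le> 1}"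
    by (auto simp: fundamental_simplex_def less_imp_le)
  have "{y. (\<forall>\<alpha>\<in>\<Delta>. 0 \<le> y \<bullet> \<alpha>) \<and> y \<bullet> \<xi> \<le> 1} = (\<Inter>\<alpha>\<in>\<Delta>. {y. 0 \<le> y \<bullet> \<alpha>}) \<inter> {y. y \<bullet> \<xi> \<le> 1}"
    by auto
  then show "closed {y. (\<forall>\<alpha>\<in>\<Delta>. 0 \<le> y \<bullet> \<alpha>) \<and> y \<bullet> \<xi> \<le> 1}"
    by (simp only:) (intro closed_Int closed_INT ballI closed_Collect_le continuous_intros)
qed

section \<open>Regular points: the complement of the affine hyperplane arrangement\<close>

definition regular :: "'a \<Rightarrow> bool" where
  "regular x \<longleftrightarrow> (\<forall>\<beta>\<in>R. x \<bullet> \<beta> \<notin> \<int>)"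

text \<open>The excluded set is a countable union of hyperplanes. The shift by \<open>v\<close> lets
  the fact be applied to translated arguments.\<close>

lemma AE_regular: "AE x in lborel. regular (x + v)"
proof -
  have "AE x in lborel. \<forall>k\<in>\<int>. (x + v) \<bullet> \<beta> \<noteq> k" if "\<beta> \<in> R" for \<beta>
  proof (rule AE_ball_countable')
    show "countable (\<int> :: real set)" by (rule countable_int)
    fix k :: real
    have "{x. \<beta> \<bullet> x = k - v \<bullet> \<beta>} \<in> null_sets lebesgue"
      using negligible_hyperplane [of \<beta> "k - v \<bullet> \<beta>"] root_nonzero that
      by (auto simp: negligible_iff_null_sets)
    moreover have "{x. \<beta> \<bullet> x = k - v \<bullet> \<beta>} \<in> sets lborel"
      using closed_hyperplane by (simp add: borel_closed)
    ultimately have "{x. \<beta> \<bullet> x = k - v \<bullet> \<beta>} \<in> null_sets lborel"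
      by (simp add: null_sets_completion_iff)
    then have "AE x in lborel. x \<notin> {x. \<beta> \<bullet> x = k - v \<bullet> \<beta>}" by (rule AE_not_in)
    then show "AE x in lborel. (x + v) \<bullet> \<beta> \<noteq> k"
      by eventually_elim (auto simp: inner_add_left inner_commute [of \<beta>])
  qed
  then have "AE x in lborel. \<forall>\<beta>\<in>R. \<forall>k\<in>\<int>. (x + v) \<bullet> \<beta> \<noteq> k"
    using finite_roots by (rule AE_finite_allI [rotated])
  then show ?thesis by eventually_elim (auto simp: regular_def)
qed

lemma regular_simplex: "y \<in> F \<Longrightarrow> regular y"
  using simplex_root_floor by (simp add: regular_def)

text \<open>Pulling \<beta> back by \<open>w\<close> gives another root, and the translation changes
  its value by an integer.\<close>

lemma regular_weyl_translate:
  assumes "regular x" "w \<in> W" "q \<in> translation_lattice" shows "regular (w (x + q))"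
  unfolding regular_def
proof
  fix \<beta> assume \<beta>: "\<beta> \<in> R"
  obtain u where u: "u \<in> W" "\<And>x. u (w x) = x" "\<And>x. w (u x) = x" using weyl_inverse assms by blast
  have "w (x + q) \<bullet> \<beta> = x \<bullet> u \<beta> + q \<bullet> u \<beta>"
    using weyl_inner [OF assms(2), of "x + q" "u \<beta>"] u by (simp add: inner_add_left)
  moreover have "u \<beta> \<in> R" using weyl_root u \<beta> by blast
  moreover have "q \<bullet> u \<beta> \<in> \<int>" using root_inner_translation \<open>u \<beta> \<in> R\<close> assms by blast
  ultimately show "w (x + q) \<bullet> \<beta> \<notin> \<int>"
    using assms(1) unfolding regular_def by (metis Ints_diff add_diff_cancel_right')
qed

text \<open>Equality in one of the inequalities would give some root an integral value at
  \<open>x\<close>.\<close>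

lemma regular_closure_simplex:
  assumes "regular x" "\<And>\<alpha>. \<alpha> \<in> \<Delta> \<Longrightarrow> 0 \<le> x \<bullet> \<alpha>" "x \<bullet> \<xi> \<le> 1" shows "x \<in> F"
proof -
  have "x \<bullet> \<alpha> \<noteq> 0" if "\<alpha> \<in> \<Delta>" for \<alpha> using assms(1) that simple_root by (force simp: regular_def)
  moreover have "x \<bullet> \<xi> \<noteq> 1" using assms(1) highest by (force simp: regular_def)
  ultimately show ?thesis using assms by (force simp: fundamental_simplex_def less_le)
qed

text \<open>The walls bounding \<open>F\<close> are permuted by the affine group together with all hyperplanes
  \<open>x \<bullet> \<beta> = k\<close>, none of which separates two points of \<open>F\<close>.\<close>

lemma simplex_tile_transfer:
  assumes "a \<in> F" "b \<in> F" "w \<in> W" "q \<in> translation_lattice" "w (a + q) \<in> F"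
  shows "w (b + q) \<in> F"
proof -
  obtain u where u: "u \<in> W" "\<And>x. u (w x) = x" "\<And>x. w (u x) = x" using weyl_inverse assms by blast
  \<comment> \<open>Pulling back by \<open>w\<close> turns \<beta> into the root
    \<open>u \<beta>\<close>, and \<open>q\<close> adds an integer; on \<open>F\<close> the floor
    depends only on the root.\<close>
  have floor: "\<lfloor>w (b + q) \<bullet> \<beta>\<rfloor> = \<lfloor>w (a + q) \<bullet> \<beta>\<rfloor>" if \<beta>: "\<beta> \<in> R" for \<beta>
  proof -
    have "u \<beta> \<in> R" using weyl_root u \<beta> by blast
    then obtain n where n: "q \<bullet> u \<beta> = of_int n"
      using root_inner_translation assms by (metis Ints_cases)
    have "w (x + q) \<bullet> \<beta> = x \<bullet> u \<beta> + of_int n" for x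
      using weyl_inner [OF assms(3), of "x + q" "u \<beta>"] u n by (simp add: inner_add_left)
    then show ?thesis
      using simplex_root_floor(2) [OF _ \<open>u \<beta> \<in> R\<close>] assms by simp
  qed
  show ?thesis
  proof (rule regular_closure_simplex)
    show "regular (w (b + q))" using regular_weyl_translate regular_simplex assms by blast
    show "0 \<le> w (b + q) \<bullet> \<alpha>" if "\<alpha> \<in> \<Delta>" for \<alpha>
    proof -
      have "0 < w (a + q) \<bullet> \<alpha>" using assms(5) that by (simp add: fundamental_simplex_def)
      then show ?thesis using floor [OF simple_root [OF that]] by (metis less_imp_le zero_le_floor)
    qed
    have "w (a + q) \<bullet> \<xi> < 1" using assms(5) by (simp add: fundamental_simplex_def)
    then show "w (b + q) \<bullet> \<xi> \<le> 1" using floor [OF highest(1)] by (metis floor_less_one less_imp_le)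
  qed
qed

text \<open>In the orbit of \<open>x\<close> the point closest to some \<open>p \<in> F\<close> lies in the closure of \<open>F\<close>,
  since otherwise reflecting it in a wall separating it from \<open>p\<close> would bring it closer.\<close>

lemma exists_tile:
  assumes "regular x"
  shows "\<exists>w\<in>W. \<exists>q\<in>translation_lattice. w (x + q) \<in> F"
proof -
  obtain p where p: "p \<in> F" using simplex_nonempty by blast
  define d where "d = (\<lambda>g :: ('a \<Rightarrow> 'a) \<times> 'a. norm (fst g (x + snd g) - p))"
  \<comment> \<open>Only images at least as close to \<open>p\<close> as \<open>x\<close> matter.
    They are finitely many, since \<open>W\<close> is finite and their translations are bounded, so
    a minimum exists.\<close>
  define A where "A = {g \<in> W \<times> translation_lattice. d g \<le> norm (x - p)}"
  have "(id, 0) \<in> A" by (simp add: A_def d_def weyl_id translation_0)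
  have "A \<subseteq> W \<times> {q \<in> translation_lattice. norm q \<le> norm (x - p) + norm p + norm x}"
  proof
    fix g assume "g \<in> A"
    then obtain w q where g: "g = (w, q)" "w \<in> W" "q \<in> translation_lattice" "norm (w (x + q) - p) \<le> norm (x - p)"
      by (auto simp: A_def d_def)
    have "norm (w (x + q)) \<le> norm (w (x + q) - p) + norm p"
      using norm_triangle_sub [of "w (x + q)" p] by (simp add: add.commute)
    then have "norm (x + q) \<le> norm (x - p) + norm p" using g weyl_norm by force
    moreover have "norm q \<le> norm (x + q) + norm x" using norm_triangle_ineq4 [of "x + q" x] by simp
    ultimately show "g \<in> W \<times> {q \<in> translation_lattice. norm q \<le> norm (x - p) + norm p + norm x}"
      using g by simp
  qed
  then have "finite A"
    using finite_weyl finite_translations by (meson finite_SigmaI finite_subset)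
  then obtain g where g: "g \<in> A" "\<And>h. h \<in> A \<Longrightarrow> d g \<le> d h"
    using \<open>(id, 0) \<in> A\<close> by (metis empty_iff arg_min_if_finite(1) arg_min_least)
  have min: "d g \<le> d h" if "h \<in> W \<times> translation_lattice" for h
    using g that by (cases "h \<in> A") (auto simp: A_def)
  obtain w q where wq: "g = (w, q)" "w \<in> W" "q \<in> translation_lattice"
    using g by (cases g) (auto simp: A_def)
  define z where "z = w (x + q)"
  have dist: "norm (z - p) ^ 2 \<le> norm (y - p) ^ 2" if "y = w' (x + q')" "w' \<in> W" "q' \<in> translation_lattice" for w' q' y
    using min [of "(w', q')"] that by (intro power_mono) (auto simp: d_def wq z_def)
  have "z \<in> F"
  proof (rule regular_closure_simplex)
    show "regular z" unfolding z_def using assms wq(2,3) by (rule regular_weyl_translate)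
  next
    fix \<alpha> assume \<alpha>: "\<alpha> \<in> \<Delta>"
    let ?k = "z \<bullet> coroot \<alpha>"
    have "norm (z - p) ^ 2 \<le> norm (root_reflection \<alpha> z - p) ^ 2"
      using wq \<alpha> by (intro dist [of _ "root_reflection \<alpha> \<circ> w" q]) (auto simp: z_def intro: weyl_compose weyl_reflection)
    moreover have "root_reflection \<alpha> z \<bullet> root_reflection \<alpha> z = z \<bullet> z"
      using orthogonal_transformation_root_reflection by (auto simp: orthogonal_transformation_def)
    \<comment> \<open>As \<open>z\<close> and its reflection have the same norm, comparing distances
      to \<open>p\<close> amounts to comparing inner products with \<open>p\<close>.\<close>
    ultimately have "root_reflection \<alpha> z \<bullet> p \<le> z \<bullet> p"
      by (simp add: power2_norm_eq_inner inner_diff_left inner_diff_right inner_commute)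
    then have "0 \<le> ?k * (\<alpha> \<bullet> p)" by (simp add: root_reflection_def inner_diff_left)
    moreover have "0 < \<alpha> \<bullet> p" using p \<alpha> by (simp add: fundamental_simplex_def inner_commute)
    ultimately have "0 \<le> ?k" by (simp add: zero_le_mult_iff)
    moreover have "0 < \<alpha> \<bullet> \<alpha>" using \<alpha> simple_root root_nonzero by simp
    ultimately show "0 \<le> z \<bullet> \<alpha>" by (simp add: coroot_def zero_le_divide_iff)
  next
    let ?r = "root_reflection \<xi>"
    let ?y = "?r z + coroot \<xi>"
    let ?k = "z \<bullet> coroot \<xi>"
    have r: "?r \<in> W" using root_reflection_in_weyl highest highest_pos by blast
    then have rw: "?r \<circ> w \<in> W" using wq weyl_compose by blast
    then obtain u where u: "u \<in> W" "\<And>x. u ((?r \<circ> w) x) = x" "\<And>x. (?r \<circ> w) (u x) = x"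
      using weyl_inverse by blast
    \<comment> \<open>\<open>u\<close> moves the final translation by \<open>coroot \<xi>\<close>
      inside the argument, which restores the form \<open>w' (x + q')\<close>.\<close>
    have tr: "q + u (coroot \<xi>) \<in> translation_lattice"
      by (rule translation_add [OF wq(3) weyl_translation [OF u(1) coroot_translation [OF highest(1) highest_pos]]])
    have "?y = (?r \<circ> w) (x + q) + (?r \<circ> w) (u (coroot \<xi>))" using u(3) by (simp add: z_def)
    then have "?y = (?r \<circ> w) (x + (q + u (coroot \<xi>)))" using weyl_add [OF rw] by (simp add: add.assoc)
    then have le: "norm (z - p) ^ 2 \<le> norm (?y - p) ^ 2" using rw tr by (rule dist)
    have pos: "0 < \<xi> \<bullet> \<xi>" using highest root_nonzero by simp
    \<comment> \<open>This is the affine reflection in the wall where the inner product with \<xi>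
      is 1.\<close>
    have y: "?y = z - (2 * (z \<bullet> \<xi> - 1) / (\<xi> \<bullet> \<xi>)) *\<^sub>R \<xi>"
      by (simp add: root_reflection_def coroot_def algebra_simps diff_divide_distrib)
    \<comment> \<open>The subtracted term is positive exactly when \<open>z\<close> lies beyond that
      wall, since \<open>p\<close> lies before it.\<close>
    have "norm (?y - p) ^ 2 = norm (z - p) ^ 2 - 4 * (z \<bullet> \<xi> - 1) * (1 - p \<bullet> \<xi>) / (\<xi> \<bullet> \<xi>)"
      unfolding y power2_norm_eq_inner using pos
      by (simp add: inner_diff_left inner_diff_right inner_commute) (simp add: field_simps power2_eq_square)
    then have "4 * (z \<bullet> \<xi> - 1) * (1 - p \<bullet> \<xi>) / (\<xi> \<bullet> \<xi>) \<le> 0" using le by simp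
    moreover have "0 < 1 - p \<bullet> \<xi>" using p by (simp add: fundamental_simplex_def)
    ultimately show "z \<bullet> \<xi> \<le> 1"
      using pos by (simp add: divide_le_0_iff mult_le_0_iff)
  qed
  then show ?thesis using wq z_def by blast
qed

end

section \<open>Orthogonality\<close>

context affine_root_system
begin

section \<open>Counting the images of a point in the simplex\<close>

definition tiles :: "'a \<Rightarrow> (('a \<Rightarrow> 'a) \<times> 'a) set" where
  "tiles x = {(w, q). w \<in> W \<and> q \<in> translation_lattice \<and> w (x + q) \<in> F}"

text \<open>Composing with the fixed group element is a bijection: \<open>w (u (x + p) + q)\<close>
  equals \<open>(w \<circ> u) (x + (p + v q))\<close>, where \<open>v\<close> is the inverse of
  \<open>u\<close>.\<close>

lemma card_tiles_weyl_translate: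
  assumes u: "u \<in> W" and p: "p \<in> translation_lattice"
  shows "card (tiles (u (x + p))) = card (tiles x)"
proof -
  obtain v where v: "v \<in> W" "\<And>x. v (u x) = x" "\<And>x. u (v x) = x" using weyl_inverse u by blast
  have "bij_betw (\<lambda>(w, q). (w \<circ> u, p + v q)) (tiles (u (x + p))) (tiles x)"
  proof (rule bij_betw_byWitness [where f' = "\<lambda>(w, q). (w \<circ> v, u (q - p))"])
    show "\<forall>g\<in>tiles (u (x + p)). (case case g of (w, q) \<Rightarrow> (w \<circ> u, p + v q) of
        (w, q) \<Rightarrow> (w \<circ> v, u (q - p))) = g"
      using v by (auto simp: fun_eq_iff)
    show "\<forall>g\<in>tiles x. (case case g of (w, q) \<Rightarrow> (w \<circ> v, u (q - p)) of
        (w, q) \<Rightarrow> (w \<circ> u, p + v q)) = g"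
      using v by (auto simp: fun_eq_iff)
    have "u (x + (p + v q)) = u (x + p) + q" for q
      using weyl_add [OF u, of "x + p" "v q"] v by (simp add: add.assoc)
    then show "(\<lambda>(w, q). (w \<circ> u, p + v q)) ` tiles (u (x + p)) \<subseteq> tiles x"
      using u p v by (auto simp: tiles_def intro!: weyl_compose translation_add weyl_translation [OF v(1)])
    have "v (u (x + p) + u (q - p)) = x + q" for q
      using weyl_add [OF u, of "x + p" "q - p"] v by (metis add.commute add_diff_cancel_left' add_diff_eq group_cancel.add1)
    then show "(\<lambda>(w, q). (w \<circ> v, u (q - p))) ` tiles x \<subseteq> tiles (u (x + p))"
      using u p v by (auto simp: tiles_def intro!: weyl_compose translation_diff weyl_translation [OF u])
  qed
  then show ?thesis by (rule bij_betw_same_card)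
qed

text \<open>Every regular point can be moved into \<open>F\<close> by the group, and any two points
  of \<open>F\<close> have the same \<open>tiles\<close>.\<close>

lemma card_tiles_constant: "\<exists>s. \<forall>x. regular x \<longrightarrow> card (tiles x) = s"
proof -
  obtain p where p: "p \<in> F" using simplex_nonempty by blast
  have "card (tiles x) = card (tiles p)" if x: "regular x" for x
  proof -
    obtain w q where wq: "w \<in> W" "q \<in> translation_lattice" "w (x + q) \<in> F"
      using exists_tile x by blast
    have "tiles (w (x + q)) = tiles p"
      using simplex_tile_transfer [OF wq(3) p] simplex_tile_transfer [OF p wq(3)]
      by (auto simp: tiles_def)
    then show ?thesis using card_tiles_weyl_translate wq by metis
  qed
  then show ?thesis by blast
qed

text \<open>Folding over \<open>W\<close> leaves only translations to sum over in the periodization.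
  Complex values let it multiply characters directly.\<close>

definition fold_count :: "'a \<Rightarrow> complex" where
  "fold_count x = (\<Sum>w\<in>W. indicator F (w x))"

lemma borel_measurable_weyl: "w \<in> W \<Longrightarrow> w \<in> borel_measurable borel"
  using orthogonal_transformation_linear [OF weyl_orthogonal, of w]
  by (intro borel_measurable_continuous_onI linear_continuous_on) (simp add: linear_conv_bounded_linear)

lemma borel_measurable_fold_count [measurable]: "fold_count \<in> borel_measurable borel"
  unfolding fold_count_def
proof (rule borel_measurable_sum)
  fix w assume "w \<in> W"
  then have [measurable]: "w \<in> borel_measurable borel" by (rule borel_measurable_weyl)
  have [measurable]: "F \<in> sets borel" using open_simplex by simp
  show "(\<lambda>x. indicator F (w x) :: complex) \<in> borel_measurable borel" by measurable
qed

lemma norm_fold_count: "norm (fold_count x) \<le> card W"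
proof -
  have "norm (fold_count x) \<le> (\<Sum>w\<in>W. 1)"
    unfolding fold_count_def by (rule sum_norm_le) (auto simp: indicator_def)
  then show ?thesis by simp
qed

lemma fold_count_support:
  assumes "\<And>y. y \<in> F \<Longrightarrow> norm y \<le> M" "fold_count x \<noteq> 0" shows "norm x \<le> M"
proof -
  have "\<exists>w\<in>W. indicator F (w x) \<noteq> (0 :: complex)"
    using assms(2) unfolding fold_count_def by (metis (no_types, lifting) sum.neutral)
  then obtain w where w: "w \<in> W" "w x \<in> F" by (auto simp: indicator_def split: if_splits)
  then show ?thesis using assms(1) [OF w(2)] weyl_norm [OF w(1)] by simp
qed

text \<open>The finite set \<open>T\<close> holds every translation that contributes, so this is the
  full periodization of \<open>fold_count\<close>.\<close>

lemma sum_fold_count: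
  assumes "finite T" "T \<subseteq> translation_lattice" "snd ` tiles x \<subseteq> T"
  shows "(\<Sum>q\<in>T. fold_count (x + q)) = of_nat (card (tiles x))"
proof -
  have "(\<Sum>q\<in>T. fold_count (x + q)) = (\<Sum>w\<in>W. \<Sum>q\<in>T. indicator F (w (x + q)))"
    unfolding fold_count_def by (rule sum.swap)
  also have "\<dots> = (\<Sum>g\<in>W \<times> T. indicator F (fst g (x + snd g)))"
    by (simp add: sum.cartesian_product case_prod_beta)
  also have "\<dots> = (\<Sum>g\<in>W \<times> T. if g \<in> tiles x then 1 else 0)"
    using assms by (intro sum.cong) (auto simp: tiles_def indicator_def)
  also have "\<dots> = of_nat (card ((W \<times> T) \<inter> tiles x))"
    using assms finite_weyl by (simp flip: sum.inter_restrict)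
  also have "(W \<times> T) \<inter> tiles x = tiles x"
    using assms(3) by (force simp: tiles_def)
  finally show ?thesis .
qed

text \<open>Both sides unfold to the integral of \<open>fold_count x * fold_count (x + v + q) * E x\<close>,
  summed over translations \<open>q\<close>, since summing either factor over the translations
  yields the constant covering number.\<close>

lemma integral_fold_count_shift:
  assumes E: "E \<in> borel_measurable borel" and bound: "\<And>x. norm (E x) \<le> 1"
    and periodic: "\<And>x q. q \<in> translation_lattice \<Longrightarrow> E (x + q) = E x"
  shows "(LINT x|lborel. fold_count x * E x) = (LINT x|lborel. fold_count (x + v) * E x)"
proof -
  note E [measurable]
  obtain M where M: "\<And>y. y \<in> F \<Longrightarrow> norm y \<le> M" using simplex_bounded by blast
  obtain s where s: "\<And>x. regular x \<Longrightarrow> card (tiles x) = s" using card_tiles_constant by blast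
  \<comment> \<open>The factor \<open>s\<close> is cancelled at the end. The identity is a tile of
    any point of \<open>F\<close>, and finiteness keeps \<open>card\<close> from defaulting to
    0.\<close>
  have "s \<noteq> 0"
  proof -
    obtain p where p: "p \<in> F" using simplex_nonempty by blast
    have "(id, 0) \<in> tiles p" using p by (simp add: tiles_def weyl_id translation_0)
    moreover have "finite (tiles p)"
    proof (rule finite_subset)
      show "tiles p \<subseteq> W \<times> {q \<in> translation_lattice. norm q \<le> M + norm p}"
      proof (clarsimp simp: tiles_def)
        fix w q assume "w \<in> W" "w (p + q) \<in> F"
        then have "norm (p + q) \<le> M" using M weyl_norm by metis
        then show "norm q \<le> M + norm p" using norm_triangle_ineq4 [of "p + q" p] by simp
      qed
    qed (use finite_weyl finite_translations in blast)
    ultimately have "card (tiles p) \<noteq> 0" by auto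
    then show ?thesis using s [OF regular_simplex [OF p]] by simp
  qed
  \<comment> \<open>If a point has norm at most \<open>M + norm v\<close> and its translate has norm
    at most \<open>M\<close>, the translation obeys this bound.\<close>
  define T where "T = {q \<in> translation_lattice. norm q \<le> 2 * M + norm v}"
  have T: "finite T" "T \<subseteq> translation_lattice" using finite_translations by (auto simp: T_def)
  have supp: "snd ` tiles x \<subseteq> T" if "norm x \<le> M + norm v" for x
  proof (clarsimp simp: tiles_def T_def)
    fix w q assume "w \<in> W" "w (x + q) \<in> F"
    then have "norm (x + q) \<le> M" using M weyl_norm by metis
    then show "norm q \<le> 2 * M + norm v" using that norm_triangle_ineq4 [of "x + q" x] by simp
  qed
  \<comment> \<open>\<open>G\<close> inserts the periodization at \<open>x + v\<close> next to
    \<open>fold_count x\<close>; \<open>H\<close> inserts the one at \<open>x\<close> next to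
    \<open>fold_count (x + v)\<close>.\<close>
  define G where "G = (\<lambda>q x. fold_count x * fold_count (x + v + q) * E x)"
  define H where "H = (\<lambda>q x. fold_count (x + q) * fold_count (x + v) * E x)"
  have G_meas: "G q \<in> borel_measurable borel" for q unfolding G_def by measurable
  have H_meas: "H q \<in> borel_measurable borel" for q unfolding H_def by measurable
  have le: "norm (a * b * e) \<le> real (card W) * real (card W)"
    if "norm a \<le> card W" "norm b \<le> card W" "norm e \<le> 1" for a b e :: complex
  proof -
    have "norm a * norm b * norm e \<le> (real (card W) * real (card W)) * 1"
      using that by (intro mult_mono) auto
    then show ?thesis by (simp add: norm_mult)
  qed
  have G_int: "integrable lborel (G q)" for q
  proof (rule integrable_lborel_bounded_support [OF G_meas])
    show "norm (G q x) \<le> real (card W) * real (card W)" for x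
      unfolding G_def by (intro le norm_fold_count bound)
    show "norm x \<le> M" if "G q x \<noteq> 0" for x using that fold_count_support [OF M] by (auto simp: G_def)
  qed
  have H_int: "integrable lborel (H q)" for q
  proof (rule integrable_lborel_bounded_support [OF H_meas])
    show "norm (H q x) \<le> real (card W) * real (card W)" for x
      unfolding H_def by (intro le norm_fold_count bound)
    show "norm x \<le> M + norm v" if "H q x \<noteq> 0" for x
    proof -
      have "norm (x + v) \<le> M" using that fold_count_support [OF M] by (auto simp: H_def)
      then show ?thesis using norm_triangle_ineq4 [of "x + v" v] by simp
    qed
  qed
  have "of_nat s * (LINT x|lborel. fold_count x * E x) = (LINT x|lborel. of_nat s * (fold_count x * E x))"
    by simp
  also have "\<dots> = (LINT x|lborel. (\<Sum>q\<in>T. G q x))"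
  proof (rule integral_cong_AE)
    show "AE x in lborel. of_nat s * (fold_count x * E x) = (\<Sum>q\<in>T. G q x)"
      using AE_regular [of v]
    proof eventually_elim
      case (elim x)
      show ?case
      proof (cases "fold_count x = 0")
        case False
        then have "norm (x + v) \<le> M + norm v"
          using fold_count_support [OF M False] norm_triangle_ineq [of x v] by simp
        then have "(\<Sum>q\<in>T. fold_count (x + v + q)) = of_nat s"
          using sum_fold_count [OF T supp] s [OF elim] by simp
        then show ?thesis by (simp add: G_def flip: sum_distrib_left sum_distrib_right)
      qed (simp add: G_def)
    qed
  qed (use G_meas in measurable)
  also have "\<dots> = (\<Sum>q\<in>T. LINT x|lborel. G q x)" using G_int by (simp add: Bochner_Integration.integral_sum)
  also have "\<dots> = (\<Sum>q\<in>T. LINT x|lborel. H (- q) x)"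
  proof (rule sum.cong)
    fix q assume "q \<in> T"
    then have "- q \<in> translation_lattice" using T translation_minus by blast
    \<comment> \<open>Substituting \<open>x - q\<close> moves the translation from the second factor
      to the first; \<open>E\<close> is unchanged by periodicity.\<close>
    then have "G q (x + - q) = H (- q) x" for x
      using periodic [of "- q" x] by (simp add: G_def H_def)
    then show "(LINT x|lborel. G q x) = (LINT x|lborel. H (- q) x)"
      using integral_lborel_translation [OF G_meas, of q "- q"] by simp
  qed simp
  also have "\<dots> = (\<Sum>q\<in>T. LINT x|lborel. H q x)"
    by (rule sum.reindex_bij_witness [of _ uminus uminus]) (auto simp: T_def translation_minus)
  also have "\<dots> = (LINT x|lborel. (\<Sum>q\<in>T. H q x))" using H_int by (simp add: Bochner_Integration.integral_sum)
  also have "\<dots> = (LINT x|lborel. of_nat s * (fold_count (x + v) * E x))"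
  proof (rule integral_cong_AE)
    show "AE x in lborel. (\<Sum>q\<in>T. H q x) = of_nat s * (fold_count (x + v) * E x)"
      using AE_regular [of 0]
    proof eventually_elim
      case (elim x)
      show ?case
      proof (cases "fold_count (x + v) = 0")
        case False
        then have "norm x \<le> M + norm v"
          using fold_count_support [OF M False] norm_triangle_ineq4 [of "x + v" v] by simp
        then have "(\<Sum>q\<in>T. fold_count (x + q)) = of_nat s"
          using sum_fold_count [OF T supp] s elim by simp
        then show ?thesis by (simp add: H_def flip: sum_distrib_left sum_distrib_right)
      qed (simp add: H_def)
    qed
  qed (use H_meas in measurable)
  also have "\<dots> = of_nat s * (LINT x|lborel. fold_count (x + v) * E x)" by simp
  finally show ?thesis using \<open>s \<noteq> 0\<close> by simp
qed

section \<open>Integrals of characters\<close>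

lemma integral_fold_count_character:
  assumes \<nu>: "\<nu> \<in> weight_lattice \<Delta>" "\<nu> \<noteq> 0"
  shows "(LINT x|lborel. fold_count x * cis (2 * pi * (\<nu> \<bullet> x))) = 0"
proof -
  let ?E = "\<lambda>x. cis (2 * pi * (\<nu> \<bullet> x))"
  \<comment> \<open>Chosen with \<open>\<nu> \<bullet> v = 1 / 2\<close>, so that a shift by
    \<open>v\<close> changes the sign of the character.\<close>
  define v where "v = (1 / (2 * (\<nu> \<bullet> \<nu>))) *\<^sub>R \<nu>"
  have E [measurable]: "?E \<in> borel_measurable borel"
    by (intro borel_measurable_continuous_onI continuous_intros)
  have "(LINT x|lborel. fold_count x * ?E x) = (LINT x|lborel. fold_count (x + v) * ?E x)"
  proof (rule integral_fold_count_shift [OF E])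
    fix x q assume "q \<in> translation_lattice"
    then have "\<nu> \<bullet> q \<in> \<int>" using \<nu> by (simp add: translation_lattice_def)
    then have "cis (2 * pi * (\<nu> \<bullet> q)) = 1" by (rule cis_multiple_2pi)
    then show "?E (x + q) = ?E x"
      by (simp add: inner_add_right distrib_left flip: cis_mult)
  qed simp
  also have "\<dots> = (LINT x|lborel. fold_count (x + - v + v) * ?E (x + - v))"
    using integral_lborel_translation [of "\<lambda>x. fold_count (x + v) * ?E x" "- v"] by simp
  also have "\<dots> = (LINT x|lborel. - (fold_count x * ?E x))"
  proof (rule Bochner_Integration.integral_cong)
    fix x
    have "?E (x + - v) = ?E x * cis (- pi)"
      using \<nu> by (simp add: cis_mult v_def inner_diff_right right_diff_distrib)
    then show "fold_count (x + - v + v) * ?E (x + - v) = - (fold_count x * ?E x)"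
      by (simp add: complex_eq_iff)
  qed simp
  also have "\<dots> = - (LINT x|lborel. fold_count x * ?E x)" by simp
  finally show ?thesis by simp
qed

text \<open>The Fourier transform of the indicator function of \<open>F\<close>, with the positive
  sign in the exponent.\<close>

definition simplex_transform :: "'a \<Rightarrow> complex" where
  "simplex_transform \<nu> = (LINT x|lborel. indicator F x * cis (2 * pi * (\<nu> \<bullet> x)))"

lemma integrable_simplex_transform:
  "w \<in> W \<Longrightarrow> integrable lborel (\<lambda>x. indicator F (w x) * cis (2 * pi * (\<nu> \<bullet> x)))"
proof -
  assume w: "w \<in> W"
  note borel_measurable_weyl [OF w, measurable]
  have [measurable]: "F \<in> sets borel" using open_simplex by simp
  have [measurable]: "(\<lambda>x. cis (2 * pi * (\<nu> \<bullet> x))) \<in> borel_measurable borel"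
    by (intro borel_measurable_continuous_onI continuous_intros)
  obtain M where M: "\<And>y. y \<in> F \<Longrightarrow> norm y \<le> M" using simplex_bounded by blast
  show ?thesis
  proof (rule integrable_lborel_bounded_support [where B = 1 and M = M])
    show "norm (indicator F (w x) * cis (2 * pi * (\<nu> \<bullet> x))) \<le> 1" for x
      by (simp add: norm_mult indicator_def)
    show "norm x \<le> M" if "indicator F (w x) * cis (2 * pi * (\<nu> \<bullet> x)) \<noteq> 0" for x
      using that M [of "w x"] weyl_norm [OF w] by (simp add: indicator_def split: if_splits)
  qed measurable
qed

text \<open>The substitution by \<open>w\<close> moves \<open>w\<close> from the frequency to the
  indicator, and these indicators sum to \<open>fold_count\<close>.\<close>

lemma sum_simplex_transform:
  assumes \<nu>: "\<nu> \<in> weight_lattice \<Delta>" "\<nu> \<noteq> 0"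
  shows "(\<Sum>w\<in>W. simplex_transform (w \<nu>)) = 0"
proof -
  have "(\<Sum>w\<in>W. simplex_transform (w \<nu>))
      = (\<Sum>w\<in>W. LINT x|lborel. indicator F (w x) * cis (2 * pi * (\<nu> \<bullet> x)))"
  proof (rule sum.cong)
    fix w assume w: "w \<in> W"
    have [measurable]: "F \<in> sets borel" using open_simplex by simp
    have [measurable]: "(\<lambda>x. cis (2 * pi * (w \<nu> \<bullet> x))) \<in> borel_measurable borel"
      by (intro borel_measurable_continuous_onI continuous_intros)
    have "simplex_transform (w \<nu>) = (LINT x|lborel. indicator F (w x) * cis (2 * pi * (w \<nu> \<bullet> w x)))"
      unfolding simplex_transform_def
      by (rule integral_lborel_orthogonal_transformation [OF weyl_orthogonal [OF w], symmetric]) measurable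
    then show "simplex_transform (w \<nu>) = (LINT x|lborel. indicator F (w x) * cis (2 * pi * (\<nu> \<bullet> x)))"
      using weyl_inner [OF w] by simp
  qed simp
  also have "\<dots> = (LINT x|lborel. fold_count x * cis (2 * pi * (\<nu> \<bullet> x)))"
    unfolding fold_count_def sum_distrib_right
    by (rule Bochner_Integration.integral_sum [symmetric]) (rule integrable_simplex_transform)
  also have "\<dots> = 0" using \<nu> by (rule integral_fold_count_character)
  finally show ?thesis .
qed

lemma simplex_transform_0: "simplex_transform 0 = of_real (measure lborel F)"
  and measure_simplex_pos: "0 < measure lborel F"
proof -
  obtain M where M: "\<And>y. y \<in> F \<Longrightarrow> norm y \<le> M" using simplex_bounded by blast
  then have "F \<subseteq> cball 0 M" by auto
  then have "emeasure lborel F \<le> emeasure lborel (cball (0 :: 'a) M)"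
    by (rule emeasure_mono) simp
  \<comment> \<open>Finiteness matters because \<open>measure\<close> of a set of infinite measure
    is 0.\<close>
  then have fin: "emeasure lborel F < \<infinity>"
    using emeasure_lborel_cball_finite le_less_trans by blast
  have F: "F \<in> sets lborel" using open_simplex by simp
  show "simplex_transform 0 = of_real (measure lborel F)"
  proof -
    have "simplex_transform 0 = (LINT x|lborel. complex_of_real (indicator F x))"
      unfolding simplex_transform_def
      by (rule Bochner_Integration.integral_cong) (simp_all add: indicator_def)
    then show ?thesis using F by simp
  qed
  have "F \<notin> null_sets lebesgue"
    using open_not_negligible [OF open_simplex] simplex_nonempty by (auto simp: negligible_iff_null_sets)
  then have "emeasure lborel F \<noteq> 0"
    using F by (metis null_setsI null_sets_completionI)
  then show "0 < measure lborel F"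
    using fin by (simp add: measure_def enn2real_positive_iff zero_less_iff_neq_zero)
qed

section \<open>Orbits and products of orbit functions\<close>

lemma finite_weyl_orbit: "finite (weyl_orbit \<Delta> l)"
proof -
  have "weyl_orbit \<Delta> l = (\<lambda>w. w l) ` W" by (auto simp: weyl_orbit_def)
  then show ?thesis using finite_weyl by simp
qed

lemma weyl_bij_orbit:
  assumes w: "w \<in> W" shows "bij_betw w (weyl_orbit \<Delta> l) (weyl_orbit \<Delta> l)"
proof -
  have "w ` weyl_orbit \<Delta> l \<subseteq> weyl_orbit \<Delta> l"
    using weyl_compose [OF w] by (auto simp: weyl_orbit_def) (metis comp_apply)
  moreover have "inj_on w (weyl_orbit \<Delta> l)"
    using weyl_bij [OF w] by (meson bij_is_inj inj_on_subset subset_UNIV)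
  ultimately show ?thesis
    using finite_weyl_orbit by (simp add: bij_betw_def endo_inj_surj)
qed

text \<open>A common point would make \<open>l'\<close> an image of \<open>l\<close> under
  \<open>W\<close>, but an orbit contains at most one dominant point.\<close>

lemma dominant_orbits_disjoint:
  assumes "l \<in> dominant_weights \<Delta>" "l' \<in> dominant_weights \<Delta>" "l \<noteq> l'"
  shows "weyl_orbit \<Delta> l \<inter> weyl_orbit \<Delta> l' = {}"
proof (rule ccontr)
  assume "\<not> ?thesis"
  then obtain w w' where w: "w \<in> W" "w' \<in> W" "w l = w' l'" by (auto simp: weyl_orbit_def)
  obtain u where u: "u \<in> W" "\<And>x. u (w' x) = x" using weyl_inverse [OF w(2)] by metis
  then have "(u \<circ> w) l = l'" "u \<circ> w \<in> W" using w weyl_compose by auto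
  then obtain as where "as \<in> lists \<Delta>" "refl_word as l = l'"
    unfolding weyl_group_eq_refl_words by (metis imageE)
  then show False
    using dominant_orbit_unique [of as l] assms by (auto simp: dominant_weights_def)
qed

text \<open>Expanding the product gives the transform at all differences \<mu> - \<mu>'. Averaging
  over \<open>W\<close> kills the nonzero differences, and the zero differences correspond to the
  common points of the two orbits.\<close>

lemma integral_orbit_functions:
  assumes l: "l \<in> weight_lattice \<Delta>" "l' \<in> weight_lattice \<Delta>"
  shows "(LINT x|lborel. indicator F x * (orbit_function \<Delta> l x * cnj (orbit_function \<Delta> l' x)))
    = of_real (measure lborel F) * of_nat (card (weyl_orbit \<Delta> l \<inter> weyl_orbit \<Delta> l'))"
proof -
  let ?O = "weyl_orbit \<Delta> l" and ?O' = "weyl_orbit \<Delta> l'"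
  have orbit: "orbit_function \<Delta> l x = (\<Sum>\<mu>\<in>weyl_orbit \<Delta> l. cis (2 * pi * (\<mu> \<bullet> x)))" for l x
    by (simp add: orbit_function_def cis_conv_exp mult_ac)
  have "orbit_function \<Delta> l x * cnj (orbit_function \<Delta> l' x)
      = (\<Sum>\<mu>\<in>?O. \<Sum>\<mu>'\<in>?O'. cis (2 * pi * ((\<mu> - \<mu>') \<bullet> x)))" for x
    by (simp add: orbit sum_product cis_cnj cis_mult inner_diff_left right_diff_distrib)
  then have "(LINT x|lborel. indicator F x * (orbit_function \<Delta> l x * cnj (orbit_function \<Delta> l' x)))
      = (LINT x|lborel. (\<Sum>\<mu>\<in>?O. \<Sum>\<mu>'\<in>?O'. indicator F x * cis (2 * pi * ((\<mu> - \<mu>') \<bullet> x))))"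
    by (simp add: sum_distrib_left)
  also have "\<dots> = (\<Sum>\<mu>\<in>?O. \<Sum>\<mu>'\<in>?O'. simplex_transform (\<mu> - \<mu>'))" (is "_ = ?S")
    unfolding simplex_transform_def using integrable_simplex_transform [OF weyl_id]
    by (simp add: Bochner_Integration.integral_sum Bochner_Integration.integrable_sum)
  finally have S: "(LINT x|lborel. indicator F x * (orbit_function \<Delta> l x * cnj (orbit_function \<Delta> l' x))) = ?S" .
  have orbit_weight: "\<mu> \<in> weight_lattice \<Delta>" if "\<mu> \<in> weyl_orbit \<Delta> l" "l \<in> weight_lattice \<Delta>" for \<mu> l
    using that weyl_weight by (auto simp: weyl_orbit_def)
  have "of_nat (card W) * ?S = (\<Sum>w\<in>W. \<Sum>\<mu>\<in>?O. \<Sum>\<mu>'\<in>?O'. simplex_transform (w \<mu> - w \<mu>'))"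
  proof -
    \<comment> \<open>\<open>w\<close> permutes both orbits, so applying it to both indices only
      reorders the sum.\<close>
    have "(\<Sum>\<mu>\<in>?O. \<Sum>\<mu>'\<in>?O'. simplex_transform (w \<mu> - w \<mu>')) = ?S" if w: "w \<in> W" for w
    proof -
      have "(\<Sum>\<mu>'\<in>?O'. simplex_transform (\<nu> - w \<mu>')) = (\<Sum>\<mu>'\<in>?O'. simplex_transform (\<nu> - \<mu>'))" for \<nu>
        by (rule sum.reindex_bij_betw [OF weyl_bij_orbit [OF w]])
      moreover have "(\<Sum>\<mu>\<in>?O. \<Sum>\<mu>'\<in>?O'. simplex_transform (w \<mu> - \<mu>')) = ?S"
        by (rule sum.reindex_bij_betw [OF weyl_bij_orbit [OF w]])
      ultimately show ?thesis by simp
    qed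
    then show ?thesis by simp
  qed
  also have "\<dots> = (\<Sum>\<mu>\<in>?O. \<Sum>\<mu>'\<in>?O'. \<Sum>w\<in>W. simplex_transform (w (\<mu> - \<mu>')))"
    by (subst sum.swap, rule sum.cong [OF refl], subst sum.swap) (simp add: weyl_diff)
  also have "\<dots> = (\<Sum>\<mu>\<in>?O. \<Sum>\<mu>'\<in>?O'. if \<mu> = \<mu>' then of_nat (card W) * of_real (measure lborel F) else 0)"
  proof (intro sum.cong refl)
    fix \<mu> \<mu>' assume "\<mu> \<in> ?O" "\<mu>' \<in> ?O'"
    then have wt: "\<mu> - \<mu>' \<in> weight_lattice \<Delta>" using l orbit_weight weight_diff by blast
    show "(\<Sum>w\<in>W. simplex_transform (w (\<mu> - \<mu>')))
        = (if \<mu> = \<mu>' then of_nat (card W) * of_real (measure lborel F) else 0)"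
    proof (cases "\<mu> = \<mu>'")
      case True
      have "simplex_transform (w (\<mu> - \<mu>')) = of_real (measure lborel F)" if "w \<in> W" for w
        using weyl_diff [OF that, of \<mu> \<mu>'] True by (simp add: simplex_transform_0)
      then show ?thesis using True by simp
    qed (use sum_simplex_transform [OF wt] in simp)
  qed
  also have "\<dots> = (\<Sum>\<mu>\<in>?O. if \<mu> \<in> ?O' then of_nat (card W) * of_real (measure lborel F) else 0)"
    using finite_weyl_orbit by simp
  also have "\<dots> = of_nat (card W) * (of_real (measure lborel F) * of_nat (card (?O \<inter> ?O')))"
    using finite_weyl_orbit by (simp flip: sum.inter_restrict)
  finally have "of_nat (card W) * ?S
      = of_nat (card W) * (of_real (measure lborel F) * of_nat (card (?O \<inter> ?O')))" .
  moreover have "card W \<noteq> 0" using finite_weyl weyl_id by auto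
  ultimately show ?thesis using S by simp
qed

text \<open>A point of the closure outside \<open>F\<close> lies on one of the hyperplanes, whose
  union is a null set.\<close>

lemma AE_closure_simplex: "AE x in lborel. x \<in> closure F \<longleftrightarrow> x \<in> F"
  using AE_regular [of 0]
proof eventually_elim
  case (elim x)
  then show ?case using regular_closure_simplex closure_simplex_subset closure_subset [of F] by auto
qed

end

theorem mainTheorem3:
  fixes R \<Delta> :: "'a::euclidean_space set" and \<xi> l l' :: 'a
  assumes "root_system R" and "crystallographic R" and "reduced R" and "irreducible_system R"
    and "normalized R"
    and "simple_roots R \<Delta>"
    and "highest_root R \<Delta> \<xi>"
    and "l \<in> dominant_weights \<Delta>" and "l' \<in> dominant_weights \<Delta>"
  shows "(LINT x:closure (fundamental_simplex \<Delta> \<xi>)|lebesgue.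
            orbit_function \<Delta> l x * cnj (orbit_function \<Delta> l' x))
         / complex_of_real (measure lebesgue (closure (fundamental_simplex \<Delta> \<xi>)))
       = of_nat (card (weyl_orbit \<Delta> l)) * (if l = l' then 1 else 0)"
proof -
  interpret affine_root_system R \<Delta> \<xi>
    by unfold_locales (fact assms)+
  let ?f = "\<lambda>x. orbit_function \<Delta> l x * cnj (orbit_function \<Delta> l' x)"
  have [measurable]: "?f \<in> borel_measurable borel"
    unfolding orbit_function_def by (intro borel_measurable_continuous_onI continuous_intros)
  have [measurable]: "F \<in> sets borel" "closure F \<in> sets borel"
    using open_simplex by auto
  \<comment> \<open>The integrand is Borel, so passing from Lebesgue measure to its restriction to
    Borel sets does not change the integral.\<close>
  have "(LINT x:closure F|lebesgue. ?f x) = (LINT x|lborel. indicator (closure F) x *\<^sub>R ?f x)"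
    unfolding set_lebesgue_integral_def by (rule integral_completion) measurable
  also have "\<dots> = (LINT x|lborel. indicator F x * ?f x)"
  proof (rule integral_cong_AE)
    show "AE x in lborel. indicator (closure F) x *\<^sub>R ?f x = indicator F x * ?f x"
      using AE_closure_simplex by eventually_elim (simp add: indicator_def)
  qed measurable
  also have "\<dots> = of_real (measure lborel F) * of_nat (card (weyl_orbit \<Delta> l \<inter> weyl_orbit \<Delta> l'))"
    using assms by (intro integral_orbit_functions) (auto simp: dominant_weights_def)
  also have "card (weyl_orbit \<Delta> l \<inter> weyl_orbit \<Delta> l') = (if l = l' then card (weyl_orbit \<Delta> l) else 0)"
    using dominant_orbits_disjoint assms by auto
  finally have int: "(LINT x:closure F|lebesgue. ?f x)
      = of_real (measure lborel F) * of_nat (if l = l' then card (weyl_orbit \<Delta> l) else 0)" .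
  have "measure lebesgue (closure F) = measure lborel (closure F)"
    by (rule measure_completion) simp
  also have "\<dots> = measure lborel F"
    using AE_closure_simplex by (intro measure_eq_AE) auto
  finally show ?thesis using measure_simplex_pos int by simp
qed

end
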